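(* Let ${\rm Br}({\rm G}_2)$, ${\rm Br}({\rm D}_4)$ and ${\rm SBr}({\rm D}_4)$ be as in the context. There is an algebra isomorphism $$\phi:\ {\rm Br}({\rm G}_2)\longrightarrow {\rm SBr}({\rm D}_4)$$ determined by $\phi(r_0)=R_1R_2R_4$, $\phi(r_1)=R_3$, $\phi(e_0)=E_1E_2E_4$ and $\phi(e_1)=E_3$. Furthermore, both ${\rm Br}({\rm G}_2)$ and ${\rm SBr}({\rm D}_4)$ are free $\mathbb{Z}[\delta^{\pm1}]$-modules of rank $39$.
   Context: Let $\delta$ be an indeterminate. ${\rm Br}({\rm G}_2)$ is the $\mathbb{Z}[\delta^{\pm1}]$-algebra generated by $r_0,r_1,e_0,e_1$ subject to the following relations: - $r_0^2=r_1^2=1$; - $r_ie_i=e_ir_i=e_i$ for $i=0,1$; - $e_0^2=\delta^3e_0$ and $e_1^2=\delta e_1$; - $r_0e_1e_0=r_1e_0$ and $e_0e_1r_0=e_0r_1$; - $e_1r_0e_1r_0e_1=e_1$ and $e_1r_0e_1r_0r_1=e_1r_0r_1r_0$; - $e_0r_1e_0=\delta^2e_0$; - $r_1r_0e_1r_0e_1=r_0r_1r_0e_1$; - $(r_1r_0)^6=1$. ${\rm Br}({\rm D}_4)$ is the $\mathbb{Z}[\delta^{\pm1}]$-algebra generated by $R_i,E_i$ for $i\in\{1,2,3,4\}$. Here node $3$ is adjacent to each of $1,2,4$, and there are no other adjacencies. Write $i\sim j$ for adjacency. The relations are: - $R_i^2=1$, $E_i^2=\delta E_i$ and $R_iE_i=E_iR_i=E_i$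 for all $i$; - for $i\not\sim j$ (with $i\neq j$): $R_iR_j=R_jR_i$, $E_iR_j=R_jE_i$ and $E_iE_j=E_jE_i$; - for $i\sim j$: $R_iR_jR_i=R_jR_iR_j$, $R_jR_iE_j=E_iE_j$ and $R_iE_jR_i=R_jE_iR_j$. Let ${\rm BrM}({\rm D}_4)$ be the submonoid of the multiplicative monoid of ${\rm Br}({\rm D}_4)$ generated by $\delta^{\pm1}$ and all $R_i,E_i$. Let $\sigma$ be the algebra automorphism of ${\rm Br}({\rm D}_4)$ given by $R_i\mapsto R_{\sigma(i)}$ and $E_i\mapsto E_{\sigma(i)}$, where $\sigma$ is the permutation $(1,2,4)$ of the nodes (fixing $3$). ${\rm SBr}({\rm D}_4)$ denotes the subalgebra of ${\rm Br}({\rm D}_4)$ generated by the $\sigma$-invariant elements of ${\rm BrM}({\rm D}_4)$. *)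

theory Defs
  imports "HOL-Library.Poly_Mapping"
begin

text \<open>Laurent polynomials over the integers, realised as the group ring of (int,+)
  over int: finitely supported functions int to int with convolution product.
  The indeterminate delta is the basis element at exponent 1.\<close>

type_synonym laurent = "int \<Rightarrow>\<^sub>0 int"

definition dpow :: "int \<Rightarrow> laurent" where
  "dpow k = Poly_Mapping.single k 1"

abbreviation delta :: laurent where "delta \<equiv> dpow 1"

text \<open>An element of the free algebra on an alphabet of generators of type 'g is a
  finitely supported function from words (lists of generators) to coefficients.\<close>

type_synonym 'g falg = "'g list \<Rightarrow> laurent"

definition FA :: "'g falg set" where
  "FA = {f. finite {w. f w \<noteq> 0}}"

definition fzero :: "'g falg" where "fzero = (\<lambda>w. 0)"
definition fadd :: "'g falg \<Rightarrow> 'g falg \<Rightarrow> 'g falg" where "fadd f g = (\<lambda>w. f w + g w)"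
definition fsub :: "'g falg \<Rightarrow> 'g falg \<Rightarrow> 'g falg" where "fsub f g = (\<lambda>w. f w - g w)"
definition smul :: "laurent \<Rightarrow> 'g falg \<Rightarrow> 'g falg" where "smul c f = (\<lambda>w. c * f w)"

text \<open>Product: concatenation of words, extended bilinearly.\<close>
definition fmul :: "'g falg \<Rightarrow> 'g falg \<Rightarrow> 'g falg" where
  "fmul f g = (\<lambda>w. \<Sum>i\<in>{0..length w}. f (take i w) * g (drop i w))"

definition wd :: "'g list \<Rightarrow> 'g falg" where
  "wd u = (\<lambda>w. if w = u then 1 else 0)"

abbreviation fone :: "'g falg" where "fone \<equiv> wd []"

definition lincomb :: "nat \<Rightarrow> (nat \<Rightarrow> laurent) \<Rightarrow> (nat \<Rightarrow> 'g falg) \<Rightarrow> 'g falg" where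
  "lincomb n c b = (\<lambda>w. \<Sum>i<n. c i * b i w)"

inductive_set gen_ideal :: "'g falg set \<Rightarrow> 'g falg set" for X where
  gi_gen: "x \<in> X \<Longrightarrow> x \<in> gen_ideal X"
| gi_zero: "fzero \<in> gen_ideal X"
| gi_add: "x \<in> gen_ideal X \<Longrightarrow> y \<in> gen_ideal X \<Longrightarrow> fadd x y \<in> gen_ideal X"
| gi_smul: "x \<in> gen_ideal X \<Longrightarrow> smul c x \<in> gen_ideal X"
| gi_lmul: "x \<in> gen_ideal X \<Longrightarrow> a \<in> FA \<Longrightarrow> fmul a x \<in> gen_ideal X"
| gi_rmul: "x \<in> gen_ideal X \<Longrightarrow> a \<in> FA \<Longrightarrow> fmul x a \<in> gen_ideal X"

inductive_set gen_subalg :: "'g falg set \<Rightarrow> 'g falg set" for X where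
  gs_gen: "x \<in> X \<Longrightarrow> x \<in> gen_subalg X"
| gs_one: "fone \<in> gen_subalg X"
| gs_add: "x \<in> gen_subalg X \<Longrightarrow> y \<in> gen_subalg X \<Longrightarrow> fadd x y \<in> gen_subalg X"
| gs_smul: "x \<in> gen_subalg X \<Longrightarrow> smul c x \<in> gen_subalg X"
| gs_mul: "x \<in> gen_subalg X \<Longrightarrow> y \<in> gen_subalg X \<Longrightarrow> fmul x y \<in> gen_subalg X"

definition word_img :: "('g \<Rightarrow> 'h falg) \<Rightarrow> 'g list \<Rightarrow> 'h falg" where
  "word_img s w = foldr (\<lambda>g acc. fmul (s g) acc) w fone"

definition subst :: "('g \<Rightarrow> 'h falg) \<Rightarrow> 'g falg \<Rightarrow> 'h falg" where
  "subst s x = (\<lambda>v. \<Sum>w\<in>{w. x w \<noteq> 0}. x w * word_img s w v)"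

text \<open>Freeness of rank n of the module M/I (where M is an L-submodule of the free
  algebra and I an ideal of it), expressed through representatives:
  there are b_0..b_{n-1} in M whose classes modulo I span (M + I)/I and are
  linearly independent over Z[delta^{+-1}].\<close>
definition free_of_rank_mod :: "'g falg set \<Rightarrow> 'g falg set \<Rightarrow> nat \<Rightarrow> bool" where
  "free_of_rank_mod M I n \<longleftrightarrow>
     (\<exists>b :: nat \<Rightarrow> 'g falg.
        (\<forall>i<n. b i \<in> M)
      \<and> (\<forall>x\<in>M. \<exists>c. fsub x (lincomb n c b) \<in> I)
      \<and> (\<forall>c. lincomb n c b \<in> I \<longrightarrow> (\<forall>i<n. c i = 0)))"

datatype g2gen = r0 | r1 | e0 | e1

definition G2_rels :: "g2gen falg set" where
  "G2_rels = {
     fsub (wd [r0, r0]) fone,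
     fsub (wd [r1, r1]) fone,
     fsub (wd [r0, e0]) (wd [e0]), fsub (wd [e0, r0]) (wd [e0]),
     fsub (wd [r1, e1]) (wd [e1]), fsub (wd [e1, r1]) (wd [e1]),
     fsub (wd [e0, e0]) (smul (dpow 3) (wd [e0])),
     fsub (wd [e1, e1]) (smul delta (wd [e1])),
     fsub (wd [r0, e1, e0]) (wd [r1, e0]),
     fsub (wd [e0, e1, r0]) (wd [e0, r1]),
     fsub (wd [e1, r0, e1, r0, e1]) (wd [e1]),
     fsub (wd [e1, r0, e1, r0, r1]) (wd [e1, r0, r1, r0]),
     fsub (wd [e0, r1, e0]) (smul (dpow 2) (wd [e0])),
     fsub (wd [r1, r0, e1, r0, e1]) (wd [r0, r1, r0, e1]),
     fsub (wd [r1, r0, r1, r0, r1, r0, r1, r0, r1, r0, r1, r0]) fone }"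

text \<open>Br(G2) is the quotient FA / I_G2.\<close>
definition I_G2 :: "g2gen falg set" where "I_G2 = gen_ideal G2_rels"

datatype node = N1 | N2 | N3 | N4

definition adj :: "node \<Rightarrow> node \<Rightarrow> bool" where
  "adj i j \<longleftrightarrow> i \<noteq> j \<and> (i = N3 \<or> j = N3)"

datatype d4gen = R node | E node

definition D4_rels :: "d4gen falg set" where
  "D4_rels =
     {fsub (wd [R i, R i]) fone | i. True}
   \<union> {fsub (wd [E i, E i]) (smul delta (wd [E i])) | i. True}
   \<union> {fsub (wd [R i, E i]) (wd [E i]) | i. True}
   \<union> {fsub (wd [E i, R i]) (wd [E i]) | i. True}
   \<union> {fsub (wd [R i, R j]) (wd [R j, R i]) | i j. i \<noteq> j \<and> \<not> adj i j}
   \<union> {fsub (wd [E i, R j]) (wd [R j, E i]) | i j. i \<noteq> j \<and> \<not> adj i j}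
   \<union> {fsub (wd [E i, E j]) (wd [E j, E i]) | i j. i \<noteq> j \<and> \<not> adj i j}
   \<union> {fsub (wd [R i, R j, R i]) (wd [R j, R i, R j]) | i j. adj i j}
   \<union> {fsub (wd [R j, R i, E j]) (wd [E i, E j]) | i j. adj i j}
   \<union> {fsub (wd [R i, E j, R i]) (wd [R j, E i, R j]) | i j. adj i j}"

text \<open>Br(D4) is the quotient FA / I_D4.\<close>
definition I_D4 :: "d4gen falg set" where "I_D4 = gen_ideal D4_rels"

fun sig :: "node \<Rightarrow> node" where
  "sig N1 = N2" | "sig N2 = N4" | "sig N4 = N1" | "sig N3 = N3"

fun sig_gen :: "d4gen \<Rightarrow> d4gen" where
  "sig_gen (R i) = R (sig i)" | "sig_gen (E i) = E (sig i)"

text \<open>The automorphism sigma of the free algebra (it preserves I_D4, hence induces the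
  automorphism sigma of Br(D4)).\<close>
definition sigma_fa :: "d4gen falg \<Rightarrow> d4gen falg" where
  "sigma_fa = subst (\<lambda>g. wd [sig_gen g])"

definition BrM_reps :: "d4gen falg set" where
  "BrM_reps = {smul (dpow k) (wd w) | k w. True}"

definition inv_BrM_reps :: "d4gen falg set" where
  "inv_BrM_reps = {m \<in> BrM_reps. fsub (sigma_fa m) m \<in> I_D4}"

text \<open>SBr(D4) is (S_D4 + I_D4) / I_D4 inside Br(D4) = FA / I_D4.\<close>
definition S_D4 :: "d4gen falg set" where
  "S_D4 = gen_subalg inv_BrM_reps"

fun phi_gen :: "g2gen \<Rightarrow> d4gen falg" where
  "phi_gen r0 = wd [R N1, R N2, R N4]"
| "phi_gen r1 = wd [R N3]"
| "phi_gen e0 = wd [E N1, E N2, E N4]"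
| "phi_gen e1 = wd [E N3]"

end

theory Submission
  imports Defs
begin

text \<open>
  All relations identify a word with a power of \<open>\<delta>\<close> times another word, so both algebras are
  spanned by monomials. In type G2, rewriting brings every word to one of 39 normal forms. In
  type D4, every monomial is a power of \<open>\<delta>\<close> times \<open>u g\<close>, where \<open>g\<close> lies in the Weyl group and
  \<open>u\<close> is one of 34 words indexed by admissible sets of orthogonal roots.

  Two invariants separate enough monomials of type D4: an action on vectors, and the action on
  half diagrams of the Brauer monoid on four strands, onto which that of type D4 maps by
  identifying nodes 2 and 4. Each gives linear functionals that vanish on the defining ideal.
  Evaluated on \<open>w\<close>, \<open>\<sigma>(w)\<close> and \<open>\<sigma>\<^sup>2(w)\<close>, they show that if \<open>u g\<close> is \<open>\<sigma>\<close>-invariant, then so is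
  the admissible set of \<open>u\<close>, and \<open>g\<close> may be taken in the dihedral group generated by \<open>R\<^sub>1R\<^sub>2R\<^sub>4\<close>
  and \<open>R\<^sub>3\<close>; hence the invariant monomials are exactly the images of monomials of type G2.
  Evaluated on the images of the 39 normal forms, they show linear independence, which yields
  injectivity and both ranks.
\<close>

subsection \<open>Free algebras and monomial presentations\<close>

lemma dpow_0 [simp]: "dpow 0 = 1"
  by (simp add: dpow_def)

lemma dpow_mult: "dpow k * dpow l = dpow (k + l)"
  by (simp add: dpow_def mult_single)

lemma dpow_mult_left: "dpow k * (dpow l * c) = dpow (k + l) * c"
  by (simp add: dpow_mult flip: mult.assoc)

lemma dpow_neq_0 [simp]: "dpow k \<noteq> 0"
  by (simp add: dpow_def)

definition mon :: "int \<Rightarrow> 'g list \<Rightarrow> 'g falg" where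
  "mon k w = smul (dpow k) (wd w)"

lemma mon_0 [simp]: "mon 0 w = wd w"
  by (simp add: mon_def smul_def)

lemma FA_fzero [simp]: "fzero \<in> FA"
  by (simp add: FA_def fzero_def)

lemma FA_wd [simp]: "wd w \<in> FA"
  by (simp add: FA_def wd_def)

lemma FA_fadd [simp]: "x \<in> FA \<Longrightarrow> y \<in> FA \<Longrightarrow> fadd x y \<in> FA"
  unfolding FA_def mem_Collect_eq
  by (rule finite_subset[of _ "{w. x w \<noteq> 0} \<union> {w. y w \<noteq> 0}"]) (auto simp: fadd_def)

lemma FA_smul [simp]: "x \<in> FA \<Longrightarrow> smul c x \<in> FA"
  unfolding FA_def mem_Collect_eq
  by (rule finite_subset[of _ "{w. x w \<noteq> 0}"]) (auto simp: smul_def)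

lemma fsub_eq: "fsub x y = fadd x (smul (- 1) y)"
  by (simp add: fsub_def fadd_def smul_def)

lemma FA_fsub [simp]: "x \<in> FA \<Longrightarrow> y \<in> FA \<Longrightarrow> fsub x y \<in> FA"
  by (simp add: fsub_eq)

lemma FA_mon [simp]: "mon k w \<in> FA"
  by (simp add: mon_def)

text \<open>Removes one word from the support at a time. Identities linear in an argument are
  thereby reduced to single words.\<close>

lemma FA_induct [consumes 1, case_names zero add]:
  assumes "x \<in> FA" and "P fzero"
    and step: "\<And>x c w. x \<in> FA \<Longrightarrow> P x \<Longrightarrow> P (fadd x (smul c (wd w)))"
  shows "P x"
proof -
  have "finite S \<Longrightarrow> (\<And>w. w \<notin> S \<Longrightarrow> x w = 0) \<Longrightarrow> P x" for S x
  proof (induction S arbitrary: x rule: finite_induct)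
    case empty
    then have "x = fzero" by (simp add: fzero_def fun_eq_iff)
    with assms(2) show ?case by simp
  next
    case (insert u S)
    define y where "y = x(u := 0)"
    have "P y" by (rule insert.IH) (use insert.prems in \<open>auto simp: y_def\<close>)
    moreover have "y \<in> FA" unfolding FA_def mem_Collect_eq
      by (rule finite_subset[OF _ insert.hyps(1)]) (use insert.prems in \<open>auto simp: y_def\<close>)
    ultimately have "P (fadd y (smul (x u) (wd u)))" by (rule step[rotated])
    also have "fadd y (smul (x u) (wd u)) = x"
      by (auto simp: y_def fadd_def smul_def wd_def fun_eq_iff)
    finally show ?case .
  qed
  moreover have "finite {w. x w \<noteq> 0}" using assms(1) unfolding FA_def by blast
  ultimately show ?thesis by blast
qed

lemma fmul_fzero_left [simp]: "fmul fzero y = fzero"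
  and fmul_fzero_right [simp]: "fmul x fzero = fzero"
  and fmul_fadd_left: "fmul (fadd x x') y = fadd (fmul x y) (fmul x' y)"
  and fmul_fadd_right: "fmul x (fadd y y') = fadd (fmul x y) (fmul x y')"
  and fmul_smul_left: "fmul (smul c x) y = smul c (fmul x y)"
  and fmul_smul_right: "fmul x (smul c y) = smul c (fmul x y)"
  by (simp_all add: fmul_def fzero_def fadd_def smul_def fun_eq_iff distrib_left distrib_right
      sum.distrib sum_distrib_left mult_ac)

lemma fmul_fsub_left: "fmul (fsub x x') y = fsub (fmul x y) (fmul x' y)"
  and fmul_fsub_right: "fmul x (fsub y y') = fsub (fmul x y) (fmul x y')"
  by (simp_all add: fsub_eq fmul_fadd_left fmul_fadd_right fmul_smul_left fmul_smul_right)

lemma fmul_wd_wd [simp]: "fmul (wd u) (wd v) = wd (u @ v)"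
proof
  fix w
  have "fmul (wd u) (wd v) w =
      (\<Sum>i\<in>{0..length w}. if i = length u then of_bool (w = u @ v) else 0)"
    unfolding fmul_def
  proof (intro sum.cong refl)
    fix i assume "i \<in> {0..length w}"
    then have "take i w = u \<and> drop i w = v \<longleftrightarrow> i = length u \<and> w = u @ v"
      by (auto simp: min_def)
    then show "wd u (take i w) * wd v (drop i w) =
        (if i = length u then of_bool (w = u @ v) else 0)"
      by (simp add: wd_def) metis
  qed
  also have "\<dots> = wd (u @ v) w"
    by (auto simp: wd_def)
  finally show "fmul (wd u) (wd v) w = wd (u @ v) w" .
qed

lemma FA_fmul [simp]:
  assumes "x \<in> FA" "y \<in> FA" shows "fmul x y \<in> FA"
  using assms(1)
proof (induction rule: FA_induct)
  case (add x c w)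
  from assms(2) have "fmul (wd w) y \<in> FA"
    by (induction rule: FA_induct) (simp_all add: fmul_fadd_right fmul_smul_right)
  with add show ?case by (simp add: fmul_fadd_left fmul_smul_left)
qed simp

section \<open>Linear functionals that vanish on an ideal\<close>

definition lin_ext :: "('g list \<Rightarrow> laurent) \<Rightarrow> 'g falg \<Rightarrow> laurent" where
  "lin_ext f x = (\<Sum>w\<in>{w. x w \<noteq> 0}. x w * f w)"

lemma lin_ext_superset:
  assumes "finite S" and "\<And>w. w \<notin> S \<Longrightarrow> x w = 0"
  shows "lin_ext f x = (\<Sum>w\<in>S. x w * f w)"
  unfolding lin_ext_def by (rule sum.mono_neutral_left) (use assms in auto)

lemma lin_ext_fzero [simp]: "lin_ext f fzero = 0"
  by (simp add: lin_ext_def fzero_def)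

lemma lin_ext_wd [simp]: "lin_ext f (wd w) = f w"
  by (simp add: lin_ext_def wd_def)

lemma lin_ext_fadd:
  assumes "x \<in> FA" "y \<in> FA"
  shows "lin_ext f (fadd x y) = lin_ext f x + lin_ext f y"
proof -
  let ?S = "{w. x w \<noteq> 0} \<union> {w. y w \<noteq> 0}"
  have fin: "finite ?S" using assms by (simp add: FA_def)
  have "lin_ext f (fadd x y) = (\<Sum>w\<in>?S. fadd x y w * f w)"
    by (rule lin_ext_superset[OF fin]) (auto simp: fadd_def)
  also have "\<dots> = (\<Sum>w\<in>?S. x w * f w) + (\<Sum>w\<in>?S. y w * f w)"
    by (simp add: fadd_def distrib_right sum.distrib)
  also have "\<dots> = lin_ext f x + lin_ext f y"
    by (subst (1 2) lin_ext_superset[OF fin]) auto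
  finally show ?thesis .
qed

lemma lin_ext_smul:
  assumes "x \<in> FA"
  shows "lin_ext f (smul c x) = c * lin_ext f x"
proof -
  have fin: "finite {w. x w \<noteq> 0}" using assms by (simp add: FA_def)
  show ?thesis
    by (subst (1 2) lin_ext_superset[OF fin])
       (auto simp: smul_def sum_distrib_left mult_ac)
qed

lemma lin_ext_fsub:
  "x \<in> FA \<Longrightarrow> y \<in> FA \<Longrightarrow> lin_ext f (fsub x y) = lin_ext f x - lin_ext f y"
  by (simp add: fsub_eq lin_ext_fadd lin_ext_smul)

lemma lin_ext_fmul:
  assumes "x \<in> FA" "y \<in> FA"
  shows "lin_ext f (fmul x y) = lin_ext (\<lambda>u. lin_ext (\<lambda>v. f (u @ v)) y) x"
  using assms(1)
proof (induction rule: FA_induct)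
  case (add x c w)
  from assms(2) have "lin_ext f (fmul (wd w) y) = lin_ext (\<lambda>v. f (w @ v)) y"
    by (induction rule: FA_induct)
       (simp_all add: fmul_fadd_right fmul_smul_right lin_ext_fadd lin_ext_smul)
  with add assms(2) show ?case
    by (simp add: fmul_fadd_left fmul_smul_left lin_ext_fadd lin_ext_smul)
qed simp

lemma gen_ideal_FA: "x \<in> gen_ideal A \<Longrightarrow> A \<subseteq> FA \<Longrightarrow> x \<in> FA"
  by (induction rule: gen_ideal.induct) auto

lemma gen_ideal_fsub: "x \<in> gen_ideal A \<Longrightarrow> y \<in> gen_ideal A \<Longrightarrow> fsub x y \<in> gen_ideal A"
  by (simp add: fsub_eq gi_add gi_smul)

lemma fsub_self [simp]: "fsub x x = fzero"
  by (simp add: fsub_def fzero_def)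

lemma gen_ideal_fsub_swap: "fsub x y \<in> gen_ideal A \<Longrightarrow> fsub y x \<in> gen_ideal A"
  by (drule gi_smul[where c = "- 1"]) (simp add: smul_def fsub_def)

lemma gen_ideal_fsub_trans:
  "fsub x y \<in> gen_ideal A \<Longrightarrow> fsub y z \<in> gen_ideal A \<Longrightarrow> fsub x z \<in> gen_ideal A"
  by (drule (1) gi_add) (simp add: fadd_def fsub_def)

lemma gen_ideal_fsub_fadd:
  "fsub x y \<in> gen_ideal A \<Longrightarrow> fsub x' y' \<in> gen_ideal A \<Longrightarrow>
    fsub (fadd x x') (fadd y y') \<in> gen_ideal A"
  by (drule (1) gi_add) (simp add: fadd_def fsub_def algebra_simps)

lemma gen_ideal_fsub_smul:
  "fsub x y \<in> gen_ideal A \<Longrightarrow> fsub (smul c x) (smul c y) \<in> gen_ideal A"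
  by (drule gi_smul[where c = c]) (simp add: smul_def fsub_def algebra_simps)

lemma gen_ideal_fsub_fmul:
  assumes "fsub x y \<in> gen_ideal A" "fsub x' y' \<in> gen_ideal A" "x \<in> FA" "y' \<in> FA"
  shows "fsub (fmul x x') (fmul y y') \<in> gen_ideal A"
proof -
  have "fsub (fmul x x') (fmul x y') \<in> gen_ideal A"
    using gi_lmul[OF assms(2,3)] by (simp add: fmul_fsub_right)
  moreover have "fsub (fmul x y') (fmul y y') \<in> gen_ideal A"
    using gi_rmul[OF assms(1,4)] by (simp add: fmul_fsub_left)
  ultimately show ?thesis by (rule gen_ideal_fsub_trans)
qed

text \<open>The ideal is spanned by relators with a word on each side. The contexts \<open>u\<close>
  and \<open>v\<close> vary in the induction because multiplication by \<open>a\<close> enlarges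
  them.\<close>

lemma lin_ext_gen_ideal:
  assumes "x \<in> gen_ideal A" and FA: "A \<subseteq> FA"
    and rels: "\<And>a u v. a \<in> A \<Longrightarrow> lin_ext (\<lambda>w. f (u @ w @ v)) a = 0"
  shows "lin_ext f x = 0"
proof -
  have "lin_ext (\<lambda>w. f (u @ w @ v)) x = 0" for u v
    using assms(1)
  proof (induction arbitrary: u v rule: gen_ideal.induct)
    case (gi_gen x)
    then show ?case by (rule rels)
  next
    case gi_zero
    show ?case by simp
  next
    case (gi_add x y)
    then show ?case using FA by (simp add: lin_ext_fadd gen_ideal_FA)
  next
    case (gi_smul x c)
    then show ?case using FA by (simp add: lin_ext_smul gen_ideal_FA)
  next
    case (gi_lmul x a)
    have "lin_ext (\<lambda>va. f (u @ (ua @ va) @ v)) x = 0" for ua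
      using gi_lmul.IH[of "u @ ua" v] by simp
    then have "lin_ext (\<lambda>w. f (u @ w @ v)) (fmul a x) = lin_ext (\<lambda>_. 0) a"
      using gi_lmul.hyps FA by (simp add: lin_ext_fmul gen_ideal_FA)
    then show ?case by (simp add: lin_ext_def)
  next
    case (gi_rmul x a)
    \<comment> \<open>Here \<open>a\<close> sits inside the inner functional, so linearity in
      \<open>a\<close> takes an induction of its own.\<close>
    have *: "lin_ext (\<lambda>ua. lin_ext (\<lambda>va. f (u @ (ua @ va) @ v)) a) x = 0"
      using gi_rmul.hyps(2)
    proof (induction rule: FA_induct)
      case zero
      show ?case by (simp add: lin_ext_def[of _ x])
    next
      case (add a c w)
      have "x \<in> FA" using gi_rmul.hyps(1) FA by (rule gen_ideal_FA)
      have "lin_ext (\<lambda>ua. g ua + c * h ua) x = lin_ext g x + c * lin_ext h x" for g h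
        by (simp add: lin_ext_def distrib_left sum.distrib sum_distrib_left mult_ac)
      then show ?case using add gi_rmul.IH[of u "w @ v"]
        by (simp add: lin_ext_fadd lin_ext_smul)
    qed
    then show ?case using gi_rmul.hyps FA by (simp add: lin_ext_fmul gen_ideal_FA)
  qed
  from this[of "[]" "[]"] show ?thesis by simp
qed

section \<open>Substitution homomorphisms\<close>

lemma subst_alt: "subst s x v = lin_ext (\<lambda>w. word_img s w v) x"
  by (simp add: subst_def lin_ext_def)

lemma subst_fzero [simp]: "subst s fzero = fzero"
  by (simp add: fun_eq_iff subst_alt) (simp add: fzero_def)

lemma subst_wd [simp]: "subst s (wd w) = word_img s w"
  by (simp add: fun_eq_iff subst_alt)

lemma subst_fadd:
  "x \<in> FA \<Longrightarrow> y \<in> FA \<Longrightarrow> subst s (fadd x y) = fadd (subst s x) (subst s y)"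
  by (simp add: fun_eq_iff subst_alt lin_ext_fadd) (simp add: fadd_def subst_alt)

lemma subst_smul: "x \<in> FA \<Longrightarrow> subst s (smul c x) = smul c (subst s x)"
  by (simp add: fun_eq_iff subst_alt lin_ext_smul) (simp add: smul_def subst_alt)

lemma subst_fsub:
  "x \<in> FA \<Longrightarrow> y \<in> FA \<Longrightarrow> subst s (fsub x y) = fsub (subst s x) (subst s y)"
  by (simp add: fsub_eq subst_fadd subst_smul)

text \<open>Covers both the map of the theorem and \<sigma>: generators go to words, hence monomials
  go to monomials.\<close>

locale word_subst =
  fixes s :: "'g \<Rightarrow> 'h falg" and h :: "'g \<Rightarrow> 'h list"
  assumes s_eq: "s g = wd (h g)"
begin

abbreviation hw :: "'g list \<Rightarrow> 'h list" where
  "hw w \<equiv> concat (map h w)"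

lemma word_img_eq: "word_img s w = wd (hw w)"
  by (induction w) (simp_all add: word_img_def s_eq)

lemma subst_mon: "subst s (mon k w) = mon k (hw w)"
  by (simp add: mon_def subst_smul word_img_eq)

lemma FA_subst [simp]: "x \<in> FA \<Longrightarrow> subst s x \<in> FA"
  by (induction rule: FA_induct) (simp_all add: subst_fadd subst_smul word_img_eq)

lemma subst_fmul:
  assumes "x \<in> FA" "y \<in> FA"
  shows "subst s (fmul x y) = fmul (subst s x) (subst s y)"
  using assms(1)
proof (induction rule: FA_induct)
  case (add x c w)
  from assms(2) have "subst s (fmul (wd w) y) = fmul (subst s (wd w)) (subst s y)"
    by (induction rule: FA_induct)
       (simp_all add: fmul_fadd_right fmul_smul_right subst_fadd subst_smul word_img_eq)
  with add assms(2) show ?case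
    by (simp add: fmul_fadd_left fmul_smul_left subst_fadd subst_smul)
qed simp

lemma subst_gen_ideal:
  assumes "x \<in> gen_ideal A" and FA: "A \<subseteq> FA"
    and rels: "\<And>a. a \<in> A \<Longrightarrow> subst s a \<in> gen_ideal B"
  shows "subst s x \<in> gen_ideal B"
  using assms(1)
  by (induction rule: gen_ideal.induct)
     (use FA in \<open>auto simp: rels subst_fadd subst_smul subst_fmul gen_ideal_FA
        intro: gen_ideal.intros\<close>)

end

lemma FA_lincomb [simp]:
  assumes "\<And>i. i < n \<Longrightarrow> b i \<in> FA" shows "lincomb n c b \<in> FA"
  using assms
proof (induction n)
  case 0
  have "lincomb 0 c b = fzero" by (simp add: lincomb_def fzero_def)
  then show ?case by simp
next
  case (Suc n)
  have "lincomb (Suc n) c b = fadd (lincomb n c b) (smul (c n) (b n))"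
    by (simp add: lincomb_def fadd_def smul_def)
  with Suc show ?case by simp
qed

lemma lin_ext_lincomb:
  assumes "\<And>i. i < n \<Longrightarrow> b i \<in> FA"
  shows "lin_ext f (lincomb n c b) = (\<Sum>i<n. c i * lin_ext f (b i))"
  using assms
proof (induction n)
  case 0
  have "lincomb 0 c b = fzero" by (simp add: lincomb_def fzero_def)
  then show ?case by simp
next
  case (Suc n)
  have "lincomb (Suc n) c b = fadd (lincomb n c b) (smul (c n) (b n))"
    by (simp add: lincomb_def fadd_def smul_def)
  with Suc show ?case by (simp add: lin_ext_fadd lin_ext_smul)
qed

lemma subst_lincomb:
  assumes "\<And>i. i < n \<Longrightarrow> b i \<in> FA"
  shows "subst s (lincomb n c b) = lincomb n c (\<lambda>i. subst s (b i))"
  using assms by (simp add: fun_eq_iff subst_alt lin_ext_lincomb) (simp add: lincomb_def subst_alt)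

section \<open>Monoids with monomial relations\<close>

text \<open>A triple \<open>(u, k, v)\<close> stands for the relation \<open>u = \<delta>\<^sup>k v\<close>.\<close>

class presented =
  fixes relators :: "('a list \<times> int \<times> 'a list) set"

definition rel_ideal :: "'g::presented falg set" where
  "rel_ideal = gen_ideal ((\<lambda>(u, k, v). fsub (wd u) (mon k v)) ` relators)"

lemma relators_FA: "(\<lambda>(u, k, v). fsub (wd u) (mon k v)) ` relators \<subseteq> FA"
  by auto

definition mon_eq :: "int \<times> 'g::presented list \<Rightarrow> int \<times> 'g list \<Rightarrow> bool" where
  "mon_eq p q \<longleftrightarrow> fsub (mon (fst p) (snd p)) (mon (fst q) (snd q)) \<in> rel_ideal"

text \<open>The monoid generated by \<open>\<delta>\<^sup>\<plusminus>\<^sup>1\<close> and the generators. It is used only through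
  the left action \<open>act\<close> of the generators and the multiplication \<open>sh k\<close> by \<open>\<delta>\<^sup>k\<close>: an identity
  between words acting on an arbitrary \<open>x\<close> is then a rewrite rule that applies inside longer words.\<close>

quotient_type (overloaded) 'g brm = "int \<times> 'g::presented list" / mon_eq
proof (rule equivpI)
  show "reflp mon_eq"
    by (simp add: reflp_def mon_eq_def rel_ideal_def gi_zero)
  show "symp mon_eq"
    unfolding symp_def mon_eq_def rel_ideal_def by (blast intro: gen_ideal_fsub_swap)
  show "transp mon_eq"
    unfolding transp_def mon_eq_def rel_ideal_def by (blast intro: gen_ideal_fsub_trans)
qed

lemma fmul_wd_mon [simp]: "fmul (wd u) (mon k w) = mon k (u @ w)"
  by (simp add: mon_def fmul_smul_right)

lemma fmul_mon_wd [simp]: "fmul (mon k u) (wd w) = mon k (u @ w)"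
  by (simp add: mon_def fmul_smul_left)

lemma smul_mon [simp]: "smul (dpow l) (mon k w) = mon (l + k) w"
  by (simp add: mon_def smul_def dpow_mult_left)

lift_definition act :: "'g::presented \<Rightarrow> 'g brm \<Rightarrow> 'g brm" is "\<lambda>g (k, w). (k, g # w)"
proof -
  fix g and p q :: "int \<times> 'g list" assume "mon_eq p q"
  then have "fmul (wd [g]) (fsub (mon (fst p) (snd p)) (mon (fst q) (snd q))) \<in> rel_ideal"
    unfolding mon_eq_def rel_ideal_def by (rule gi_lmul) simp
  then show "mon_eq (case p of (k, w) \<Rightarrow> (k, g # w)) (case q of (k, w) \<Rightarrow> (k, g # w))"
    by (cases p; cases q) (simp add: mon_eq_def fmul_fsub_right)
qed

lift_definition sh :: "int \<Rightarrow> 'g::presented brm \<Rightarrow> 'g brm" is "\<lambda>l (k, w). (l + k, w)"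
proof -
  fix l and p q :: "int \<times> 'g list" assume "mon_eq p q"
  then have "fsub (smul (dpow l) (mon (fst p) (snd p)))
      (smul (dpow l) (mon (fst q) (snd q))) \<in> rel_ideal"
    unfolding mon_eq_def rel_ideal_def by (rule gen_ideal_fsub_smul)
  then show "mon_eq (case p of (k, w) \<Rightarrow> (l + k, w)) (case q of (k, w) \<Rightarrow> (l + k, w))"
    by (cases p; cases q) (simp add: mon_eq_def)
qed

lift_definition munit :: "'g::presented brm" is "(0, [])" .

definition acts :: "'g::presented list \<Rightarrow> 'g brm \<Rightarrow> 'g brm" where
  "acts w x = foldr act w x"

lemma acts_Nil [simp]: "acts [] x = x"
  and acts_Cons [simp]: "acts (g # w) x = act g (acts w x)"
  by (simp_all add: acts_def)

lemma acts_append [simp]: "acts (u @ v) x = acts u (acts v x)"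
  by (induction u) simp_all

lemma sh_0 [simp]: "sh 0 x = x"
  by transfer (auto simp: mon_eq_def rel_ideal_def gi_zero)

lemma sh_sh [simp]: "sh k (sh l x) = sh (k + l) x"
  by transfer (auto simp: mon_eq_def rel_ideal_def gi_zero add_ac)

lemma act_sh [simp]: "act g (sh k x) = sh k (act g x)"
  by transfer (auto simp: mon_eq_def rel_ideal_def gi_zero)

lemma acts_sh [simp]: "acts w (sh k x) = sh k (acts w x)"
  by (induction w) simp_all

lemma acts_munit: "sh k (acts w munit) = abs_brm (k, w)"
proof (induction w arbitrary: k)
  case Nil
  show ?case by (simp add: munit_def sh.abs_eq)
next
  case (Cons g w)
  from Cons[of 0] show ?case by (simp add: act.abs_eq sh.abs_eq)
qed

lemma brm_cases: obtains k w where "x = sh k (acts w munit)"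
proof -
  have "\<exists>k w. x = abs_brm (k, w)" by (induction x rule: brm.abs_induct) auto
  with that show thesis by (auto simp: acts_munit)
qed

text \<open>The dictionary between rewriting in the monoid and membership in the ideal.\<close>

lemma brm_eq_iff:
  "sh k (acts u munit) = sh l (acts v munit) \<longleftrightarrow> fsub (mon k u) (mon l v) \<in> rel_ideal"
  by (simp add: acts_munit brm.abs_eq_iff mon_eq_def)

lemma acts_relator:
  assumes "(u, k, v) \<in> relators"
  shows "acts u x = sh k (acts v x)"
proof -
  obtain j w where x: "x = sh j (acts w munit)" by (rule brm_cases)
  from assms have "fsub (wd u) (mon k v) \<in> rel_ideal"
    unfolding rel_ideal_def by (force intro: gi_gen)
  then have "smul (dpow j) (fmul (fsub (wd u) (mon k v)) (wd w)) \<in> rel_ideal"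
    unfolding rel_ideal_def by (intro gi_smul gi_rmul) simp_all
  also have "smul (dpow j) (fmul (fsub (wd u) (mon k v)) (wd w)) =
      fsub (mon j (u @ w)) (mon (k + j) (v @ w))"
    unfolding fmul_fsub_left fmul_wd_wd fmul_mon_wd
    by (simp add: mon_def fsub_def smul_def fun_eq_iff right_diff_distrib dpow_mult_left
        add.commute)
  finally have "sh j (acts (u @ w) munit) = sh (k + j) (acts (v @ w) munit)"
    by (simp only: brm_eq_iff)
  then show ?thesis by (simp add: x)
qed

lemma FA_span:
  fixes N :: "'g::presented list list"
  assumes "x \<in> FA"
    and N: "\<And>w. \<exists>k. \<exists>v\<in>set N. acts w munit = sh k (acts v munit)"
  shows "\<exists>c. fsub x (lincomb (length N) c (\<lambda>i. wd (N ! i))) \<in> rel_ideal"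
  using assms(1)
proof (induction rule: FA_induct)
  case zero
  have "lincomb (length N) (\<lambda>_. 0) (\<lambda>i. wd (N ! i)) = fzero"
    by (simp add: lincomb_def fzero_def)
  then show ?case by (metis fsub_self gi_zero rel_ideal_def)
next
  case (add x a w)
  then obtain c where c: "fsub x (lincomb (length N) c (\<lambda>i. wd (N ! i))) \<in> rel_ideal" by blast
  from N[of w] obtain k j where j: "j < length N"
    and "sh 0 (acts w munit) = sh k (acts (N ! j) munit)"
    by (auto simp: in_set_conv_nth)
  then have "fsub (wd w) (mon k (N ! j)) \<in> rel_ideal" by (simp only: brm_eq_iff mon_0)
  with c have *: "fsub (fadd x (smul a (wd w)))
      (fadd (lincomb (length N) c (\<lambda>i. wd (N ! i))) (smul a (mon k (N ! j)))) \<in> rel_ideal"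
    unfolding rel_ideal_def by (intro gen_ideal_fsub_fadd gen_ideal_fsub_smul)
  have eq: "fadd (lincomb (length N) c (\<lambda>i. wd (N ! i))) (smul a (mon k (N ! j))) =
      lincomb (length N) (\<lambda>i. c i + (if i = j then a * dpow k else 0)) (\<lambda>i. wd (N ! i))"
    using j by (simp add: lincomb_def fadd_def smul_def mon_def fun_eq_iff distrib_right
        sum.distrib if_distrib[of "\<lambda>c. c * _"] mult.assoc cong: if_cong)
  show ?case using * unfolding eq by blast
qed

subsection \<open>Normal forms in the Brauer monoid of type G2\<close>

instantiation g2gen :: presented
begin

definition relators_g2gen :: "(g2gen list \<times> int \<times> g2gen list) set" where
  "relators_g2gen =
    {([r0, r0], 0, []), ([r1, r1], 0, []),
     ([r0, e0], 0, [e0]), ([e0, r0], 0, [e0]),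
     ([r1, e1], 0, [e1]), ([e1, r1], 0, [e1]),
     ([e0, e0], 3, [e0]), ([e1, e1], 1, [e1]),
     ([r0, e1, e0], 0, [r1, e0]), ([e0, e1, r0], 0, [e0, r1]),
     ([e1, r0, e1, r0, e1], 0, [e1]), ([e1, r0, e1, r0, r1], 0, [e1, r0, r1, r0]),
     ([e0, r1, e0], 2, [e0]), ([r1, r0, e1, r0, e1], 0, [r0, r1, r0, e1]),
     ([r1, r0, r1, r0, r1, r0, r1, r0, r1, r0, r1, r0], 0, [])}"

instance ..

end

lemma rel_ideal_g2: "rel_ideal = I_G2"
  unfolding rel_ideal_def I_G2_def relators_g2gen_def G2_rels_def
  by (simp add: mon_def[of 1] mon_def[of 2] mon_def[of 3])

lemma g2_rules:
  "act r0 (act r0 x) = x" "act r1 (act r1 x) = x"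
  "act r0 (act e0 x) = act e0 x" "act e0 (act r0 x) = act e0 x"
  "act r1 (act e1 x) = act e1 x" "act e1 (act r1 x) = act e1 x"
  "act e0 (act e0 x) = sh 3 (act e0 x)" "act e1 (act e1 x) = sh 1 (act e1 x)"
  "act r0 (act e1 (act e0 x)) = act r1 (act e0 x)"
  "act e0 (act e1 (act r0 x)) = act e0 (act r1 x)"
  "act e1 (act r0 (act e1 (act r0 (act e1 x)))) = act e1 x"
  "act e1 (act r0 (act e1 (act r0 (act r1 x)))) = act e1 (act r0 (act r1 (act r0 x)))"
  "act e0 (act r1 (act e0 x)) = sh 2 (act e0 x)"
  "act r1 (act r0 (act e1 (act r0 (act e1 x)))) = act r0 (act r1 (act r0 (act e1 x)))"
  using acts_relator[of "[r0, r0]" 0 "[]" x] acts_relator[of "[r1, r1]" 0 "[]" x]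
    acts_relator[of "[r0, e0]" 0 "[e0]" x] acts_relator[of "[e0, r0]" 0 "[e0]" x]
    acts_relator[of "[r1, e1]" 0 "[e1]" x] acts_relator[of "[e1, r1]" 0 "[e1]" x]
    acts_relator[of "[e0, e0]" 3 "[e0]" x] acts_relator[of "[e1, e1]" 1 "[e1]" x]
    acts_relator[of "[r0, e1, e0]" 0 "[r1, e0]" x] acts_relator[of "[e0, e1, r0]" 0 "[e0, r1]" x]
    acts_relator[of "[e1, r0, e1, r0, e1]" 0 "[e1]" x]
    acts_relator[of "[e1, r0, e1, r0, r1]" 0 "[e1, r0, r1, r0]" x]
    acts_relator[of "[e0, r1, e0]" 2 "[e0]" x]
    acts_relator[of "[r1, r0, e1, r0, e1]" 0 "[r0, r1, r0, e1]" x]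
  by (simp_all add: relators_g2gen_def)

text \<open>Consequences of overlapping left-hand sides. Together with \<open>g2_rules\<close> and
  \<open>g2_braid\<close> they rewrite each product of a generator and a normal word to a normal
  word.\<close>

lemma g2_derived_rules:
  "act r0 (act r1 (act e0 x)) = act e1 (act e0 x)"
  "act e0 (act e1 (act e0 x)) = sh 2 (act e0 x)"
  "act e0 (act r1 (act r0 x)) = act e0 (act e1 x)"
  "act e1 (act r0 (act r1 (act r0 (act r1 x)))) = act e1 (act r0 (act e1 (act r0 x)))"
  "act e1 (act r0 (act r1 (act r0 (act e1 x)))) = act e1 x"
  "act r1 (act r0 (act r1 (act r0 (act e1 x)))) = act r0 (act e1 (act r0 (act e1 x)))"
  "act r1 (act r0 (act e1 (act r0 (act r1 (act r0 x))))) =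
    act r0 (act r1 (act r0 (act e1 (act r0 (act r1 x)))))"
  by (metis g2_rules(1,9), metis g2_rules(4,9,13), metis g2_rules(1,10),
      metis g2_rules(2,12), metis g2_rules(5,11,12), metis g2_rules(2,14),
      metis g2_rules(12,14))

lemma g2_braid:
  "act r1 (act r0 (act r1 (act r0 (act r1 (act r0 x))))) =
    act r0 (act r1 (act r0 (act r1 (act r0 (act r1 x)))))"
proof -
  have "act r1 (act r0 (act r1 (act r0 (act r1 (act r0 (act r1 (act r0 (act r1 (act r0
      (act r1 (act r0 y))))))))))) = y" for y
    using acts_relator[of "[r1, r0, r1, r0, r1, r0, r1, r0, r1, r0, r1, r0]" 0 "[]" y]
    by (simp add: relators_g2gen_def)
  \<comment> \<open>Half of the relator cancels against this argument, since \<open>r0\<close> and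
    \<open>r1\<close> are involutions.\<close>
  from this[of "act r0 (act r1 (act r0 (act r1 (act r0 (act r1 x)))))"]
  show ?thesis by (simp add: g2_rules(1,2))
qed

text \<open>12 words in \<open>r0\<close> and \<open>r1\<close> for the dihedral group, 18 words
  with \<open>e1\<close> but not \<open>e0\<close>, and 9 words with \<open>e0\<close>.\<close>

definition g2_words :: "g2gen list list" where
  "g2_words = [
    [], [r0], [r1], [e0], [e1], [r1, r0], [e1, r0], [r0, r1], [e0, r1], [r1, e0], [e1, e0],
    [r0, e1], [e0, e1], [r0, r1, r0], [r0, e1, r0], [r1, r0, r1], [e1, r0, r1], [r1, e0, r1],
    [e1, e0, r1], [r1, r0, e1], [e1, r0, e1], [r1, e0, e1], [e1, e0, e1], [r1, r0, r1, r0],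
    [e1, r0, r1, r0], [r1, r0, e1, r0], [e1, r0, e1, r0], [r0, r1, r0, r1], [r0, e1, r0, r1],
    [r0, r1, r0, e1], [r0, e1, r0, e1], [r0, r1, r0, r1, r0], [r0, e1, r0, r1, r0],
    [r0, r1, r0, e1, r0], [r0, e1, r0, e1, r0], [r1, r0, r1, r0, r1], [r1, r0, e1, r0, r1],
    [r0, r1, r0, r1, r0, r1], [r0, r1, r0, e1, r0, r1]]"

lemma length_g2_words: "length g2_words = 39"
  by (simp add: g2_words_def)

definition g2_normal :: "g2gen brm \<Rightarrow> bool" where
  "g2_normal x \<longleftrightarrow> (\<exists>k. \<exists>v\<in>set g2_words. x = sh k (acts v munit))"

lemma g2_normal_sh [simp]: "g2_normal (sh k x) \<longleftrightarrow> g2_normal x"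
proof
  assume "g2_normal (sh k x)"
  then obtain l v where "v \<in> set g2_words" "sh k x = sh l (acts v munit)"
    by (auto simp: g2_normal_def)
  moreover from this have "x = sh (l - k) (acts v munit)"
    by (metis add.left_inverse diff_conv_add_uminus add.commute sh_0 sh_sh)
  ultimately show "g2_normal x" by (auto simp: g2_normal_def)
next
  assume "g2_normal x"
  then show "g2_normal (sh k x)" unfolding g2_normal_def by (metis sh_sh)
qed

lemma g2_normal_words: "\<forall>v\<in>set g2_words. g2_normal (acts v munit)"
  unfolding g2_normal_def by (metis sh_0)

lemma g2_normal_act_words: "\<forall>v\<in>set g2_words. g2_normal (act g (acts v munit))"
proof -
  note nf = g2_normal_words[unfolded g2_words_def, simplified]
  show ?thesis
    by (cases g; simp add: g2_words_def g2_rules g2_derived_rules g2_braid nf)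
qed

lemma g2_normal_form: "\<exists>k. \<exists>v\<in>set g2_words. acts w munit = sh k (acts v munit)"
proof -
  have "g2_normal (acts w munit)"
  proof (induction w)
    case Nil
    show ?case using g2_normal_words by (auto simp: g2_words_def)
  next
    case (Cons g w)
    then obtain k v where "v \<in> set g2_words" "acts w munit = sh k (acts v munit)"
      by (auto simp: g2_normal_def)
    with g2_normal_act_words show ?case by simp
  qed
  then show ?thesis by (simp add: g2_normal_def)
qed

subsection \<open>Left normal forms in the Brauer monoid of type D4\<close>

instantiation d4gen :: presented
begin

definition relators_d4gen :: "(d4gen list \<times> int \<times> d4gen list) set" where
  "relators_d4gen =
     {([R i, R i], 0, []) | i. True}
   \<union> {([E i, E i], 1, [E i]) | i. True}
   \<union> {([R i, E i], 0, [E i]) | i. True}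
   \<union> {([E i, R i], 0, [E i]) | i. True}
   \<union> {([R i, R j], 0, [R j, R i]) | i j. i \<noteq> j \<and> \<not> adj i j}
   \<union> {([E i, R j], 0, [R j, E i]) | i j. i \<noteq> j \<and> \<not> adj i j}
   \<union> {([E i, E j], 0, [E j, E i]) | i j. i \<noteq> j \<and> \<not> adj i j}
   \<union> {([R i, R j, R i], 0, [R j, R i, R j]) | i j. adj i j}
   \<union> {([R j, R i, E j], 0, [E i, E j]) | i j. adj i j}
   \<union> {([R i, E j, R i], 0, [R j, E i, R j]) | i j. adj i j}"

instance ..

end

lemma rel_ideal_d4: "rel_ideal = I_D4"
proof -
  let ?f = "\<lambda>(u, k, v). fsub (wd u) (mon k v) :: d4gen falg"
  have 1: "?f ` {(u i, k i, v i) | i :: node. True} =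
      {fsub (wd (u i)) (mon (k i) (v i)) | i. True}" for u k v
    by (fastforce simp: image_iff)
  have 2: "?f ` {(u i j, k i j, v i j) | i j :: node. P i j} =
      {fsub (wd (u i j)) (mon (k i j) (v i j)) | i j. P i j}" for u k v P
    by (fastforce simp: image_iff)
  show ?thesis
    unfolding rel_ideal_def I_D4_def relators_d4gen_def D4_rels_def
    by (simp only: image_Un 1 2 mon_0 mon_def[of 1])
qed

abbreviation rr :: "node \<Rightarrow> d4gen brm \<Rightarrow> d4gen brm" where "rr i \<equiv> act (R i)"
abbreviation ee :: "node \<Rightarrow> d4gen brm \<Rightarrow> d4gen brm" where "ee i \<equiv> act (E i)"

lemma rr_rr [simp]: "rr i (rr i x) = x"
  using acts_relator[of "[R i, R i]" 0 "[]" x] by (auto simp: relators_d4gen_def)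

lemma ee_ee [simp]: "ee i (ee i x) = sh 1 (ee i x)"
  using acts_relator[of "[E i, E i]" 1 "[E i]" x] by (auto simp: relators_d4gen_def)

lemma rr_ee [simp]: "rr i (ee i x) = ee i x"
  using acts_relator[of "[R i, E i]" 0 "[E i]" x] by (auto simp: relators_d4gen_def)

lemma ee_rr [simp]: "ee i (rr i x) = ee i x"
  using acts_relator[of "[E i, R i]" 0 "[E i]" x] by (auto simp: relators_d4gen_def)

context
  fixes a b :: node
  assumes leaves: "a \<noteq> N3" "b \<noteq> N3"
begin

lemma rr_leaf_commute: "rr a (rr b x) = rr b (rr a x)"
  using acts_relator[of "[R a, R b]" 0 "[R b, R a]" x] leaves
  by (cases "a = b") (auto simp: relators_d4gen_def adj_def)

lemma ee_rr_leaf_commute: "ee a (rr b x) = rr b (ee a x)"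
  using acts_relator[of "[E a, R b]" 0 "[R b, E a]" x] leaves
  by (cases "a = b") (auto simp: relators_d4gen_def adj_def)

lemma ee_leaf_commute: "ee a (ee b x) = ee b (ee a x)"
  using acts_relator[of "[E a, E b]" 0 "[E b, E a]" x] leaves
  by (cases "a = b") (auto simp: relators_d4gen_def adj_def)

end

context
  fixes i j :: node
  assumes adj: "adj i j"
begin

lemma rr_braid: "rr i (rr j (rr i x)) = rr j (rr i (rr j x))"
  using acts_relator[of "[R i, R j, R i]" 0 "[R j, R i, R j]" x] adj
  by (auto simp: relators_d4gen_def)

lemma rr_rr_ee: "rr j (rr i (ee j x)) = ee i (ee j x)"
  using acts_relator[of "[R j, R i, E j]" 0 "[E i, E j]" x] adj
  by (auto simp: relators_d4gen_def)

lemma rr_ee_rr: "rr i (ee j (rr i x)) = rr j (ee i (rr j x))"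
  using acts_relator[of "[R i, E j, R i]" 0 "[R j, E i, R j]" x] adj
  by (auto simp: relators_d4gen_def)

end

lemma adj_sym: "adj i j \<Longrightarrow> adj j i"
  by (auto simp: adj_def)

context
  fixes i j :: node
  assumes adj: "adj i j"
begin

text \<open>The exchange rule \<open>rr_ee_rr\<close> makes the outer reflections cancel. As the
  diagram is connected, all \<open>E i\<close> are conjugate under the Weyl group.\<close>

lemma ee_conj: "rr j (rr i (ee j (rr i (rr j x)))) = ee i x"
  by (simp add: rr_ee_rr[OF adj])

lemma ee_rr_rr: "ee i (rr j (rr i x)) = ee i (ee j x)"
  using rr_rr_ee[OF adj, of x] rr_ee_rr[OF adj, of "rr i x"] by simp

lemma ee_ee_ee: "ee i (ee j (ee i x)) = ee i x"
proof -
  have "ee i (ee j (ee i x)) = rr j (rr i (ee j (ee i x)))" by (simp add: rr_rr_ee[OF adj])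
  also have "\<dots> = rr j (rr i (rr i (rr j (ee i x))))"
    by (simp only: rr_rr_ee[OF adj_sym[OF adj]])
  finally show ?thesis by simp
qed

lemma ee_rr_ee: "ee i (rr j (ee i x)) = ee i x"
  using ee_rr_rr[of "ee i x"] by (simp add: ee_ee_ee)

end

lemma adj_leaf [simp]: "a \<noteq> N3 \<Longrightarrow> adj a N3" "a \<noteq> N3 \<Longrightarrow> adj N3 a"
  by (auto simp: adj_def)

section \<open>Products of generators with top words\<close>

text \<open>The reflection in the root \<open>\<alpha>\<^sub>3 + \<alpha>\<^sub>a + \<alpha>\<^sub>b\<close>, which is orthogonal to \<open>\<alpha>\<^sub>3\<close>.\<close>

definition refl2 :: "node \<Rightarrow> node \<Rightarrow> d4gen brm \<Rightarrow> d4gen brm" where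
  "refl2 a b x = rr a (rr b (rr N3 (rr a (rr b x))))"

context
  fixes a b :: node
  assumes leaves: "a \<noteq> N3" "b \<noteq> N3" "a \<noteq> b"
begin

lemma refl2_eq: "refl2 a b x = rr a (rr N3 (rr b (rr N3 (rr a x))))"
proof -
  have "rr b (rr N3 (rr b y)) = rr N3 (rr b (rr N3 y))" for y
    by (rule rr_braid) (simp add: leaves)
  then show ?thesis
    unfolding refl2_def using leaves by (simp add: rr_leaf_commute[of a b])
qed

lemma refl2_ee: "refl2 a b (ee N3 x) = ee N3 (refl2 a b x)"
proof -
  \<comment> \<open>\<open>refl2 a b\<close> and \<open>ee N3\<close> are conjugates of
    \<open>rr b\<close> and \<open>ee a\<close> by the same Weyl element, and \<open>rr b\<close>
    commutes with \<open>ee a\<close>.\<close>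
  have e: "ee N3 y = rr a (rr N3 (ee a (rr N3 (rr a y))))" for y
    by (simp add: ee_conj leaves)
  show ?thesis
    unfolding refl2_eq e using leaves by (simp add: ee_rr_leaf_commute[of a b])
qed

lemma refl2_rr: "refl2 a b (rr N3 x) = rr N3 (refl2 a b x)"
proof -
  have e: "rr N3 y = rr a (rr N3 (rr a (rr N3 (rr a y))))" for y
    by (simp add: rr_braid[of N3 a] leaves)
  have "refl2 a b (rr a (rr N3 (rr a (rr N3 (rr a x))))) =
      rr a (rr N3 (rr a (rr N3 (rr a (refl2 a b x)))))"
    unfolding refl2_eq using leaves by (simp add: rr_leaf_commute[of a b])
  then show ?thesis by (simp add: e[symmetric])
qed

lemma refl2_refl2: "refl2 a b (refl2 a b x) = x"
  unfolding refl2_eq by simp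

text \<open>The rules gathered in \<open>top_rules\<close> and \<open>top_rules3\<close> serve to
  multiply a word of \<open>d4_tops\<close> by a generator, pushing any remaining Weyl element to
  its right. Here \<open>rr N3\<close> fixes the root
  \<open>\<alpha>\<^sub>3 + \<alpha>\<^sub>a + \<alpha>\<^sub>b\<close>, so the top word stays and
  \<open>refl2\<close> is left over.\<close>

lemma rr3_rr_rr_ee3: "rr N3 (rr a (rr b (ee N3 x))) = rr a (rr b (ee N3 (refl2 a b x)))"
proof -
  have "rr a (rr b (ee N3 (refl2 a b x))) = rr a (rr b (refl2 a b (ee N3 x)))"
    by (simp add: refl2_ee)
  then show ?thesis by (simp add: refl2_def rr_leaf_commute[of a b] leaves)
qed

lemma rr_rr3_rr_ee3: "rr b (rr N3 (rr a (ee N3 x))) = rr N3 (rr a (ee N3 (refl2 a b x)))"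
proof -
  have "rr N3 (rr a (ee N3 (refl2 a b x))) = ee a (ee N3 (refl2 a b x))"
    by (simp add: rr_rr_ee leaves)
  also have "\<dots> = ee a (refl2 a b (ee N3 x))" by (simp add: refl2_ee)
  also have "\<dots> = rr b (ee a (rr N3 (rr a (rr b (ee N3 x)))))"
    by (simp add: refl2_def ee_rr_leaf_commute leaves)
  also have "\<dots> = rr b (ee a (ee N3 (rr b (ee N3 x))))" by (simp add: ee_rr_rr leaves)
  also have "\<dots> = rr b (rr N3 (rr a (ee N3 x)))" by (simp add: ee_rr_ee rr_rr_ee leaves)
  finally show ?thesis by simp
qed

text \<open>\<open>\<alpha>\<^sub>3\<close> and
  \<open>\<alpha>\<^sub>3 + \<alpha>\<^sub>a + \<alpha>\<^sub>b\<close> form an orthogonal pair, the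
  image of \<open>{\<alpha>\<^sub>a, \<alpha>\<^sub>b}\<close> under \<open>rr N3\<close> followed
  by \<open>rr a\<close>.\<close>

lemma ee3_rr_rr_ee3:
  "ee N3 (rr a (rr b (ee N3 x))) = rr a (rr N3 (ee a (ee b (rr N3 (rr a x)))))"
proof -
  have "rr a (rr N3 (ee a (ee b (rr N3 (rr a x))))) = ee N3 (ee a (ee b (rr N3 (rr a x))))"
    by (simp add: rr_rr_ee leaves)
  also have "\<dots> = ee N3 (ee b (ee a (ee N3 x)))"
    by (simp add: ee_leaf_commute[of a b] ee_rr_rr leaves)
  also have "\<dots> = ee N3 (ee b (rr N3 (rr a (ee N3 x))))"
    by (simp add: rr_rr_ee leaves)
  also have "\<dots> = ee N3 (rr b (rr a (ee N3 x)))"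
    using ee_rr_rr[of N3 b "rr N3 (rr a (ee N3 x))"] leaves by simp
  finally show ?thesis by (simp add: rr_leaf_commute[of a b] leaves)
qed

lemma rr_rr3_ee_ee: "rr b (rr N3 (ee a (ee b x))) = rr a (rr N3 (ee a (ee b x)))"
  using rr_rr_ee[of N3 b "ee a x"] rr_rr_ee[of N3 a "ee b x"] leaves
  by (simp add: ee_leaf_commute[of b a])

end

lemma rr_rr3_rr_ee3_same: "a \<noteq> N3 \<Longrightarrow> rr a (rr N3 (rr a (ee N3 x))) = rr N3 (rr a (ee N3 x))"
  by (simp add: rr_rr_ee)

lemma rr3_rr_rr3_ee: "a \<noteq> N3 \<Longrightarrow> rr N3 (rr a (rr N3 (ee a x))) = rr a (rr N3 (ee a x))"
  by (simp add: rr_rr_ee)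

lemma ee3_ee: "a \<noteq> N3 \<Longrightarrow> ee N3 (ee a x) = rr a (rr N3 (ee a x))"
  by (simp add: rr_rr_ee)

lemma ee3_rr_rr3_ee: "a \<noteq> N3 \<Longrightarrow> ee N3 (rr a (rr N3 (ee a x))) = sh 1 (rr a (rr N3 (ee a x)))"
  by (simp add: rr_rr_ee)

context
  fixes a b c :: node
  assumes leaves: "a \<noteq> N3" "b \<noteq> N3" "c \<noteq> N3" and distinct: "a \<noteq> b" "c \<noteq> a" "c \<noteq> b"
begin

lemma rr3_rr_rr3_ee_ee:
  "rr N3 (rr c (rr N3 (ee a (ee b x)))) = rr c (rr N3 (ee a (ee b (rr c x))))"
  by (simp add: rr_braid[of N3 c] ee_rr_leaf_commute[of _ c] leaves)

lemma rr_rr_rr3_ee_ee: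
  "rr b (rr c (rr N3 (ee a (ee b x)))) = rr a (rr c (rr N3 (ee a (ee b x))))"
  by (simp add: rr_leaf_commute[of _ c] rr_rr3_ee_ee leaves distinct)

lemma rr_orth_pair:
  "rr a (rr N3 (rr a (rr c (rr N3 (ee a (ee b x)))))) =
    rr N3 (rr a (rr c (rr N3 (ee a (ee b (rr c x))))))"
  "rr b (rr N3 (rr a (rr c (rr N3 (ee a (ee b x)))))) =
    rr N3 (rr a (rr c (rr N3 (ee a (ee b (rr c x))))))"
proof -
  have *: "rr d (rr N3 (rr d (rr c (rr N3 (ee a (ee b x)))))) =
      rr N3 (rr d (rr c (rr N3 (ee a (ee b (rr c x))))))" if "d \<noteq> N3" for d
    by (simp add: rr_braid[of d N3] that rr3_rr_rr3_ee_ee)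
  from *[of a] leaves show "rr a (rr N3 (rr a (rr c (rr N3 (ee a (ee b x)))))) =
      rr N3 (rr a (rr c (rr N3 (ee a (ee b (rr c x))))))" by simp
  from *[of b] leaves show "rr b (rr N3 (rr a (rr c (rr N3 (ee a (ee b x)))))) =
      rr N3 (rr a (rr c (rr N3 (ee a (ee b (rr c x))))))" by (simp add: rr_rr_rr3_ee_ee)
qed

lemma rr_same_pair:
  "rr c (rr N3 (rr a (rr c (rr N3 (ee a x))))) = rr N3 (rr a (rr c (rr N3 (ee a x))))"
  by (simp add: rr_leaf_commute[of a c] leaves rr_braid[of c N3] rr3_rr_rr3_ee)

lemma ee3_rr_rr_rr3_ee: "ee N3 (rr a (rr c (rr N3 (ee a x)))) = rr a (rr N3 (ee a x))"
  by (simp add: rr_leaf_commute[of a c] leaves rr_rr_ee ee_rr_ee)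

lemma ee3_rr_rr3_ee_ee:
  "ee N3 (rr c (rr N3 (ee a (ee b x)))) = rr a (rr N3 (ee a (ee b (ee c x))))"
proof -
  have "ee N3 (rr c (rr N3 (ee a (ee b x)))) = ee N3 (ee a (ee b (ee c x)))"
    by (simp add: ee_rr_rr ee_leaf_commute[of _ c] leaves)
  then show ?thesis by (simp add: rr_rr_ee leaves)
qed

lemma rr_rr3_ee_ee_ee:
  "rr c (rr N3 (ee a (ee b (ee c x)))) = rr a (rr N3 (ee a (ee b (ee c x))))"
proof -
  have "rr c (rr N3 (ee a (ee b (ee c x)))) = ee N3 (ee a (ee b (ee c x)))"
    by (simp add: ee_leaf_commute[of _ c] rr_rr_ee leaves)
  then show ?thesis by (simp add: rr_rr_ee leaves)
qed

text \<open>The reflection in \<open>\<alpha>\<^sub>3 + \<alpha>\<^sub>a + \<alpha>\<^sub>b + \<alpha>\<^sub>c\<close> is conjugate to \<open>R\<^sub>a\<close> by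
  \<open>refl2 b c\<close>, which commutes with \<open>E\<^sub>3\<close> and \<open>R\<^sub>3\<close>.\<close>

lemma leaves_ee3_leaves:
  "rr a (rr b (rr c (ee N3 (rr a (rr b (rr c x)))))) = refl2 b c (ee a (refl2 b c x))"
proof -
  have "rr a (rr b (rr c (ee N3 (rr a (rr b (rr c x)))))) =
      rr b (rr c (rr a (ee N3 (rr a (rr b (rr c x))))))"
    using leaves by (simp add: rr_leaf_commute[of a])
  also have "\<dots> = refl2 b c (ee a (refl2 b c x))"
    using leaves by (subst rr_ee_rr)
      (simp_all add: refl2_def rr_leaf_commute[of b c] ee_rr_leaf_commute)
  finally show ?thesis .
qed

lemma leaves_rr3_leaves:
  "rr a (rr b (rr c (rr N3 (rr a (rr b (rr c x)))))) = refl2 b c (rr a (refl2 b c x))"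
proof -
  have "rr a (rr b (rr c (rr N3 (rr a (rr b (rr c x)))))) =
      rr b (rr c (rr a (rr N3 (rr a (rr b (rr c x))))))"
    using leaves by (simp add: rr_leaf_commute[of a])
  also have "\<dots> = refl2 b c (rr a (refl2 b c x))"
    using leaves by (subst rr_braid)
      (simp_all add: refl2_def rr_leaf_commute[of b c] rr_leaf_commute[of a])
  finally show ?thesis .
qed

text \<open>\<open>\<alpha>\<^sub>3\<close> and its image under the three leaf reflections are not
  orthogonal, so a single root survives. Conjugation by \<open>refl2 b c\<close> reduces the claim
  to \<open>ee_rr_rr\<close>.\<close>

lemma ee3_leaves_ee3:
  "ee N3 (rr a (rr b (rr c (ee N3 x)))) =
    ee N3 (rr a (rr b (rr c (rr N3 (rr a (rr b (rr c (rr N3 (rr a (rr b (rr c x)))))))))))"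
proof -
  let ?w = "refl2 b c"
  let ?p = "\<lambda>x. rr a (rr b (rr c x))"
  have w: "?w (ee N3 y) = ee N3 (?w y)" "?w (rr N3 y) = rr N3 (?w y)" for y
    using leaves distinct by (simp_all add: refl2_ee refl2_rr)
  have "ee N3 (?p (ee N3 x)) = ee N3 (?p (ee N3 (?p (?p x))))"
    using leaves by (simp add: rr_leaf_commute[of a] rr_leaf_commute[of b c])
  also have "\<dots> = ?w (ee N3 (ee a (?w (?p x))))" by (simp only: leaves_ee3_leaves w)
  also have "\<dots> = ?w (ee N3 (rr a (rr N3 (?w (?p x)))))" using leaves by (simp add: ee_rr_rr)
  also have "\<dots> = ee N3 (?w (rr a (?w (rr N3 (?p x)))))" by (simp add: w)
  also have "\<dots> = ee N3 (?p (rr N3 (?p (rr N3 (?p x)))))"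
    by (simp only: leaves_rr3_leaves[of "rr N3 (?p x)"])
  finally show ?thesis .
qed

lemma rr_rr3_leaves_ee3:
  "rr a (rr N3 (rr a (rr b (rr c (ee N3 x))))) =
    rr N3 (rr a (rr b (rr c (ee N3 (refl2 b c x)))))"
proof -
  have "rr N3 (rr a (rr b (rr c (ee N3 (refl2 b c x))))) =
      rr N3 (rr a (rr b (rr c (refl2 b c (ee N3 x)))))"
    using leaves distinct by (simp add: refl2_ee)
  also have "\<dots> = rr N3 (rr a (rr N3 (rr b (rr c (ee N3 x)))))"
    using leaves by (simp add: refl2_def rr_leaf_commute[of b c])
  also have "\<dots> = rr a (rr N3 (rr a (rr b (rr c (ee N3 x)))))"
    using leaves by (simp add: rr_braid[of N3 a])
  finally show ?thesis by simp
qed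

end

text \<open>Oriented for rewriting: leaves are sorted as N1, N2, N4, and a leaf reflection moves to
  the right of \<open>ee\<close> at another leaf.\<close>

lemmas leaf_order =
  rr_leaf_commute[of N2 N1, simplified] rr_leaf_commute[of N4 N1, simplified]
  rr_leaf_commute[of N4 N2, simplified]
  ee_leaf_commute[of N2 N1, simplified] ee_leaf_commute[of N4 N1, simplified]
  ee_leaf_commute[of N4 N2, simplified]
  ee_rr_leaf_commute[of N1 N2, simplified, symmetric]
  ee_rr_leaf_commute[of N1 N4, simplified, symmetric]
  ee_rr_leaf_commute[of N2 N1, simplified, symmetric]
  ee_rr_leaf_commute[of N2 N4, simplified, symmetric]
  ee_rr_leaf_commute[of N4 N1, simplified, symmetric]
  ee_rr_leaf_commute[of N4 N2, simplified, symmetric]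

lemmas top_rules =
  rr3_rr_rr_ee3 rr_rr3_rr_ee3 ee3_rr_rr_ee3 rr_rr3_ee_ee rr_rr3_rr_ee3_same rr3_rr_rr3_ee
  ee3_ee ee3_rr_rr3_ee rr3_rr_rr3_ee_ee rr_rr_rr3_ee_ee ee3_rr_rr3_ee_ee ee_rr_ee rr_rr3_ee_ee_ee

text \<open>One instance for each labelling of the leaves that occurs, sorted by
  \<open>leaf_order\<close> so that the left-hand sides match.\<close>

lemmas top_rules3 =
  rr_orth_pair[of N1 N2 N4, simplified] rr_orth_pair[of N1 N4 N2, simplified]
  rr_orth_pair[of N2 N4 N1, simplified leaf_order, simplified]
  rr_same_pair[of N1 N4 N2, simplified] rr_same_pair[of N1 N2 N4, simplified]
  rr_same_pair[of N2 N4 N1, simplified leaf_order, simplified]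
  ee3_rr_rr_rr3_ee[of N1 N4 N2, simplified] ee3_rr_rr_rr3_ee[of N1 N2 N4, simplified]
  ee3_rr_rr_rr3_ee[of N2 N4 N1, simplified leaf_order, simplified]
  ee3_leaves_ee3[of N1 N2 N4, simplified]
  rr_rr3_leaves_ee3[of N1 N2 N4, simplified]
  rr_rr3_leaves_ee3[of N2 N1 N4, simplified leaf_order, simplified]
  rr_rr3_leaves_ee3[of N4 N1 N2, simplified leaf_order, simplified]


text \<open>One word for each of the 34 admissible sets of mutually orthogonal roots: the empty set,
  the 12 positive roots, the 18 orthogonal pairs and the 3 orthogonal quadruples.\<close>

definition d4_tops :: "d4gen list list" where
  "d4_tops = [
    [], [E N3], [R N1, E N3], [R N2, E N3], [R N4, E N3], [R N1, R N2, E N3],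
    [R N1, R N4, E N3], [R N2, R N4, E N3], [R N3, R N1, E N3], [R N3, R N2, E N3],
    [R N3, R N4, E N3], [R N1, R N2, R N4, E N3], [R N3, R N1, R N2, R N4, E N3], [E N1, E N2],
    [R N3, E N1, E N2], [R N1, R N3, E N1, E N2], [R N4, R N3, E N1, E N2],
    [R N1, R N4, R N3, E N1, E N2], [R N3, R N1, R N4, R N3, E N1, E N2], [E N1, E N4],
    [R N3, E N1, E N4], [R N1, R N3, E N1, E N4], [R N2, R N3, E N1, E N4],
    [R N1, R N2, R N3, E N1, E N4], [R N3, R N1, R N2, R N3, E N1, E N4], [E N2, E N4],
    [R N3, E N2, E N4], [R N2, R N3, E N2, E N4], [R N1, R N3, E N2, E N4],
    [R N1, R N2, R N3, E N2, E N4], [R N3, R N1, R N2, R N3, E N2, E N4], [E N1, E N2, E N4],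
    [R N3, E N1, E N2, E N4], [R N1, R N3, E N1, E N2, E N4]]"

inductive_set parabolic :: "node set \<Rightarrow> d4gen brm set" for J where
  parabolic_munit [simp]: "munit \<in> parabolic J"
| parabolic_rr [simp]: "z \<in> parabolic J \<Longrightarrow> i \<in> J \<Longrightarrow> rr i z \<in> parabolic J"

abbreviation weyl :: "d4gen brm set" where
  "weyl \<equiv> parabolic UNIV"

lemma weyl_refl2 [simp]: "z \<in> weyl \<Longrightarrow> refl2 a b z \<in> weyl"
  by (simp add: refl2_def)

definition d4_normal :: "d4gen brm \<Rightarrow> bool" where
  "d4_normal y \<longleftrightarrow> (\<exists>k. \<exists>u\<in>set d4_tops. \<exists>z\<in>weyl. y = sh k (acts u z))"

lemma d4_normal_sh: "d4_normal y \<Longrightarrow> d4_normal (sh k y)"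
  unfolding d4_normal_def by (metis sh_sh)

lemma d4_normal_tops: "z \<in> weyl \<Longrightarrow> \<forall>u\<in>set d4_tops. d4_normal (acts u z)"
  unfolding d4_normal_def by (metis sh_0)

lemmas d4_normal_tops_unfolded = d4_normal_tops[unfolded d4_tops_def, simplified]

lemma d4_normal_rr_tops:
  assumes "z \<in> weyl"
  shows "\<forall>u\<in>set d4_tops. d4_normal (rr i (acts u z))"
  using assms
  by (cases i; simp add: d4_tops_def d4_normal_tops_unfolded d4_normal_sh leaf_order
      top_rules top_rules3)

lemma d4_normal_ee3_tops:
  assumes "z \<in> weyl"
  shows "\<forall>u\<in>set d4_tops. d4_normal (ee N3 (acts u z))"
  using assms
  by (simp add: d4_tops_def d4_normal_tops_unfolded d4_normal_sh leaf_order top_rules top_rules3)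

lemma d4_normal_rr: "d4_normal y \<Longrightarrow> d4_normal (rr i y)"
  using d4_normal_rr_tops by (auto simp: d4_normal_def[of y] intro!: d4_normal_sh)

lemma d4_normal_ee: "d4_normal y \<Longrightarrow> d4_normal (ee i y)"
proof -
  have *: "d4_normal y \<Longrightarrow> d4_normal (ee N3 y)" for y
    using d4_normal_ee3_tops by (auto simp: d4_normal_def[of y] intro!: d4_normal_sh)
  assume "d4_normal y"
  \<comment> \<open>Only \<open>ee N3\<close> needs the table of top words; the other
    \<open>ee i\<close> are its conjugates by \<open>ee_conj\<close>.\<close>
  then have "d4_normal (rr N3 (rr i (ee N3 (rr i (rr N3 y)))))"
    by (intro * d4_normal_rr)
  with * \<open>d4_normal y\<close> show ?thesis
    by (cases "i = N3") (auto simp: ee_conj)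
qed

lemma d4_normal_acts: "d4_normal (acts w munit)"
proof (induction w)
  case Nil
  show ?case using d4_normal_tops[OF parabolic_munit] by (auto simp: d4_tops_def)
next
  case (Cons g w)
  then show ?case by (cases g) (simp_all add: d4_normal_rr d4_normal_ee)
qed

subsection \<open>Words for the Weyl group of type D4\<close>

definition coset_normal :: "d4gen list list \<Rightarrow> node set \<Rightarrow> d4gen brm \<Rightarrow> bool" where
  "coset_normal T J y \<longleftrightarrow> (\<exists>t\<in>set T. \<exists>z\<in>parabolic J. y = acts t z)"

lemma coset_normalI: "z \<in> parabolic J \<Longrightarrow> \<forall>t\<in>set T. coset_normal T J (acts t z)"
  by (auto simp: coset_normal_def)

lemma coset_normal_parabolic:
  assumes step: "\<And>i z. i \<in> K \<Longrightarrow> z \<in> parabolic J \<Longrightarrow>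
      \<forall>t\<in>set T. coset_normal T J (rr i (acts t z))"
    and "[] \<in> set T" and "z \<in> parabolic K"
  shows "coset_normal T J z"
  using assms(3)
proof induction
  case parabolic_munit
  show ?case
    using coset_normalI[OF parabolic.parabolic_munit, where T = T and J = J] assms(2)
    by fastforce
next
  case (parabolic_rr z i)
  then show ?case using step by (auto simp: coset_normal_def[of _ _ z])
qed

text \<open>Coset representatives for the chain of parabolic subgroups generated by
  \<open>{R\<^sub>1, R\<^sub>2, R\<^sub>3, R\<^sub>4}\<close>, \<open>{R\<^sub>1, R\<^sub>2, R\<^sub>3}\<close>, \<open>{R\<^sub>1, R\<^sub>3}\<close>, \<open>{R\<^sub>1}\<close> and \<open>\<emptyset>\<close>.\<close>

definition cosets4 :: "d4gen list list" where
  "cosets4 = [[], [R N4], [R N3, R N4], [R N1, R N3, R N4], [R N2, R N3, R N4],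
    [R N1, R N2, R N3, R N4], [R N3, R N1, R N2, R N3, R N4], [R N4, R N3, R N1, R N2, R N3, R N4]]"

definition cosets3 :: "d4gen list list" where
  "cosets3 = [[], [R N2], [R N3, R N2], [R N1, R N3, R N2]]"

definition cosets2 :: "d4gen list list" where
  "cosets2 = [[], [R N3], [R N1, R N3]]"

definition cosets1 :: "d4gen list list" where
  "cosets1 = [[], [R N1]]"

text \<open>They turn a generator in front of a representative into another representative, or into
  the same one followed by a reflection from the smaller parabolic.\<close>

lemma cosets4_rules:
  "rr N1 (rr N4 x) = rr N4 (rr N1 x)"
  "rr N2 (rr N4 x) = rr N4 (rr N2 x)"
  "rr N2 (rr N1 x) = rr N1 (rr N2 x)"
  "rr N3 (rr N1 (rr N3 (rr N4 x))) = rr N1 (rr N3 (rr N4 (rr N1 x)))"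
  "rr N3 (rr N2 (rr N3 (rr N4 x))) = rr N2 (rr N3 (rr N4 (rr N2 x)))"
  "rr N4 (rr N3 (rr N4 x)) = rr N3 (rr N4 (rr N3 x))"
  "rr N4 (rr N1 (rr N3 (rr N4 x))) = rr N1 (rr N3 (rr N4 (rr N3 x)))"
  "rr N4 (rr N2 (rr N3 (rr N4 x))) = rr N2 (rr N3 (rr N4 (rr N3 x)))"
  "rr N4 (rr N1 (rr N2 (rr N3 (rr N4 x)))) = rr N1 (rr N2 (rr N3 (rr N4 (rr N3 x))))"
  "rr N1 (rr N3 (rr N1 (rr N2 (rr N3 (rr N4 x))))) =
    rr N3 (rr N1 (rr N2 (rr N3 (rr N4 (rr N2 x)))))"
  "rr N2 (rr N3 (rr N1 (rr N2 (rr N3 (rr N4 x))))) =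
    rr N3 (rr N1 (rr N2 (rr N3 (rr N4 (rr N1 x)))))"
  "rr N3 (rr N4 (rr N3 (rr N1 (rr N2 (rr N3 (rr N4 x)))))) =
    rr N4 (rr N3 (rr N1 (rr N2 (rr N3 (rr N4 (rr N3 x))))))"
proof -
  have comm: "rr N1 (rr N4 x) = rr N4 (rr N1 x)" "rr N2 (rr N4 x) = rr N4 (rr N2 x)"
    "rr N2 (rr N1 x) = rr N1 (rr N2 x)" for x
    by (simp_all add: rr_leaf_commute)
  have b4: "rr N4 (rr N3 (rr N4 x)) = rr N3 (rr N4 (rr N3 x))"
    and b1: "rr N3 (rr N1 (rr N3 x)) = rr N1 (rr N3 (rr N1 x))"
    and b2: "rr N3 (rr N2 (rr N3 x)) = rr N2 (rr N3 (rr N2 x))" for x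
    by (rule rr_braid, simp)+
  show "rr N1 (rr N4 x) = rr N4 (rr N1 x)" "rr N2 (rr N4 x) = rr N4 (rr N2 x)"
    "rr N2 (rr N1 x) = rr N1 (rr N2 x)" "rr N4 (rr N3 (rr N4 x)) = rr N3 (rr N4 (rr N3 x))"
    by (fact comm b4)+
  show "rr N3 (rr N1 (rr N3 (rr N4 x))) = rr N1 (rr N3 (rr N4 (rr N1 x)))"
    "rr N3 (rr N2 (rr N3 (rr N4 x))) = rr N2 (rr N3 (rr N4 (rr N2 x)))"
    by (simp_all only: b1 b2 comm)
  have c1: "rr N4 (rr N1 (rr N3 (rr N4 x))) = rr N1 (rr N3 (rr N4 (rr N3 x)))"
    and c2: "rr N4 (rr N2 (rr N3 (rr N4 x))) = rr N2 (rr N3 (rr N4 (rr N3 x)))" for x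
    by (simp_all only: comm(1,2)[symmetric] b4)
  show "rr N4 (rr N1 (rr N3 (rr N4 x))) = rr N1 (rr N3 (rr N4 (rr N3 x)))"
    "rr N4 (rr N2 (rr N3 (rr N4 x))) = rr N2 (rr N3 (rr N4 (rr N3 x)))" by (fact c1 c2)+
  have c12: "rr N4 (rr N1 (rr N2 (rr N3 (rr N4 x)))) = rr N1 (rr N2 (rr N3 (rr N4 (rr N3 x))))" for x
    by (simp only: comm(1)[symmetric] c2)
  show "rr N4 (rr N1 (rr N2 (rr N3 (rr N4 x)))) = rr N1 (rr N2 (rr N3 (rr N4 (rr N3 x))))"
    by (fact c12)
  show "rr N1 (rr N3 (rr N1 (rr N2 (rr N3 (rr N4 x))))) =
      rr N3 (rr N1 (rr N2 (rr N3 (rr N4 (rr N2 x)))))"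
    by (simp only: b1[symmetric] b2 comm)
  have "rr N2 (rr N3 (rr N1 (rr N2 (rr N3 (rr N4 x))))) =
      rr N2 (rr N3 (rr N2 (rr N1 (rr N3 (rr N4 x)))))" by (simp only: comm)
  also have "\<dots> = rr N3 (rr N2 (rr N1 (rr N3 (rr N1 (rr N4 x)))))" by (simp only: b2[symmetric] b1)
  also have "\<dots> = rr N3 (rr N1 (rr N2 (rr N3 (rr N4 (rr N1 x)))))" by (simp only: comm)
  finally show "rr N2 (rr N3 (rr N1 (rr N2 (rr N3 (rr N4 x))))) =
      rr N3 (rr N1 (rr N2 (rr N3 (rr N4 (rr N1 x)))))" .
  have "rr N3 (rr N4 (rr N3 (rr N1 (rr N2 (rr N3 (rr N4 x)))))) =
      rr N4 (rr N3 (rr N4 (rr N1 (rr N2 (rr N3 (rr N4 x))))))" by (simp only: b4)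
  also have "\<dots> = rr N4 (rr N3 (rr N1 (rr N2 (rr N3 (rr N4 (rr N3 x))))))" by (simp only: c12)
  finally show "rr N3 (rr N4 (rr N3 (rr N1 (rr N2 (rr N3 (rr N4 x)))))) =
      rr N4 (rr N3 (rr N1 (rr N2 (rr N3 (rr N4 (rr N3 x))))))" .
qed

lemma coset_normal4: "z \<in> weyl \<Longrightarrow> coset_normal cosets4 {N1, N2, N3} z"
proof (rule coset_normal_parabolic[rotated 2])
  fix i z assume z: "z \<in> parabolic {N1, N2, N3}"
  note nf = coset_normalI[where T = cosets4 and J = "{N1, N2, N3}", unfolded cosets4_def,
      simplified, folded cosets4_def]
  show "\<forall>t\<in>set cosets4. coset_normal cosets4 {N1, N2, N3} (rr i (acts t z))"
    unfolding cosets4_def ball_simps list.set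
    by (cases i; simp add: cosets4_rules nf z flip: cosets4_def)
qed (simp_all add: cosets4_def)

lemma cosets3_rules:
  "rr N1 (rr N2 x) = rr N2 (rr N1 x)"
  "rr N2 (rr N3 (rr N2 x)) = rr N3 (rr N2 (rr N3 x))"
  "rr N3 (rr N1 (rr N3 (rr N2 x))) = rr N1 (rr N3 (rr N2 (rr N1 x)))"
  "rr N2 (rr N1 (rr N3 (rr N2 x))) = rr N1 (rr N3 (rr N2 (rr N3 x)))"
proof -
  show c: "rr N1 (rr N2 x) = rr N2 (rr N1 x)" for x by (simp add: rr_leaf_commute)
  show b: "rr N2 (rr N3 (rr N2 x)) = rr N3 (rr N2 (rr N3 x))" for x by (rule rr_braid) simp
  show "rr N3 (rr N1 (rr N3 (rr N2 x))) = rr N1 (rr N3 (rr N2 (rr N1 x)))"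
    using rr_braid[of N3 N1 "rr N2 x"] by (simp add: c)
  show "rr N2 (rr N1 (rr N3 (rr N2 x))) = rr N1 (rr N3 (rr N2 (rr N3 x)))"
    by (simp only: c[symmetric] b)
qed

lemma coset_normal3: "z \<in> parabolic {N1, N2, N3} \<Longrightarrow> coset_normal cosets3 {N1, N3} z"
proof (rule coset_normal_parabolic[rotated 2])
  fix i z assume i: "i \<in> {N1, N2, N3}" and z: "z \<in> parabolic {N1, N3}"
  note nf = coset_normalI[where T = cosets3 and J = "{N1, N3}", unfolded cosets3_def,
      simplified, folded cosets3_def]
  show "\<forall>t\<in>set cosets3. coset_normal cosets3 {N1, N3} (rr i (acts t z))"
    using i unfolding cosets3_def ball_simps list.set
    by (cases i; simp add: cosets3_rules nf z flip: cosets3_def)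
qed (simp_all add: cosets3_def)

lemma coset_normal2: "z \<in> parabolic {N1, N3} \<Longrightarrow> coset_normal cosets2 {N1} z"
proof (rule coset_normal_parabolic[rotated 2])
  fix i z assume i: "i \<in> {N1, N3}" and z: "z \<in> parabolic {N1}"
  note nf = coset_normalI[where T = cosets2 and J = "{N1}", unfolded cosets2_def,
      simplified, folded cosets2_def]
  show "\<forall>t\<in>set cosets2. coset_normal cosets2 {N1} (rr i (acts t z))"
    using i unfolding cosets2_def ball_simps list.set
    by (cases i; simp add: rr_braid[of N3 N1] nf z flip: cosets2_def)
qed (simp_all add: cosets2_def)

lemma coset_normal1: "z \<in> parabolic {N1} \<Longrightarrow> coset_normal cosets1 {} z"
proof (rule coset_normal_parabolic[rotated 2])
  fix i :: node and z assume i: "i \<in> {N1}" and z: "z \<in> parabolic {}"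
  note nf = coset_normalI[where T = cosets1 and J = "{}", unfolded cosets1_def,
      simplified, folded cosets1_def]
  show "\<forall>t\<in>set cosets1. coset_normal cosets1 {} (rr i (acts t z))"
    using i unfolding cosets1_def ball_simps list.set
    by (simp add: nf z flip: cosets1_def)
qed (simp_all add: cosets1_def)

lemma parabolic_empty: "z \<in> parabolic {} \<Longrightarrow> z = munit"
  by (induction rule: parabolic.induct) simp_all

text \<open>8 * 4 * 3 * 2 = 192 words, the order of the Weyl group of type D4.\<close>

definition weyl_words :: "d4gen list list" where
  "weyl_words = concat (map (\<lambda>t4. concat (map (\<lambda>t3. concat (map (\<lambda>t2.
     map (\<lambda>t1. t4 @ t3 @ t2 @ t1) cosets1) cosets2)) cosets3)) cosets4)"

lemma weyl_cases:
  assumes "z \<in> weyl"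
  obtains g where "g \<in> set weyl_words" "z = acts g munit"
proof -
  from coset_normal4[OF assms] obtain t4 z4
    where 4: "t4 \<in> set cosets4" "z4 \<in> parabolic {N1, N2, N3}" "z = acts t4 z4"
    by (auto simp: coset_normal_def)
  from coset_normal3[OF 4(2)] obtain t3 z3
    where 3: "t3 \<in> set cosets3" "z3 \<in> parabolic {N1, N3}" "z4 = acts t3 z3"
    by (auto simp: coset_normal_def)
  from coset_normal2[OF 3(2)] obtain t2 z2
    where 2: "t2 \<in> set cosets2" "z2 \<in> parabolic {N1}" "z3 = acts t2 z2"
    by (auto simp: coset_normal_def)
  from coset_normal1[OF 2(2)] obtain t1
    where 1: "t1 \<in> set cosets1" "z2 = acts t1 munit"
    by (auto simp: coset_normal_def dest: parabolic_empty)
  show thesis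
    by (rule that[of "t4 @ t3 @ t2 @ t1"]) (use 1 2 3 4 in \<open>force simp: weyl_words_def\<close>)+
qed

subsection \<open>Invariants of words\<close>

text \<open>The Weyl group acts on \<open>\<int>\<^sup>4\<close> by signed permutations, and \<open>E\<^sub>i\<close> maps \<open>v\<close> to
  \<open>sgn \<langle>\<beta>\<^sub>i, v\<rangle> \<beta>\<^sub>i\<close> for a suitable vector \<open>\<beta>\<^sub>i\<close> fixed by \<open>R\<^sub>i\<close>. Replacing the scalar by its
  sign makes \<open>\<delta>\<close> act as 1.\<close>

type_synonym vec = "int \<times> int \<times> int \<times> int"

fun vact :: "d4gen \<Rightarrow> vec \<Rightarrow> vec" where
  "vact (R N1) (a, b, c, d) = (b, a, c, d)"
| "vact (R N3) (a, b, c, d) = (a, c, b, d)"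
| "vact (R N2) (a, b, c, d) = (a, b, d, c)"
| "vact (R N4) (a, b, c, d) = (a, b, - d, - c)"
| "vact (E N1) (a, b, c, d) = (let s = sgn (a + b) in (s, s, 0, 0))"
| "vact (E N3) (a, b, c, d) = (let s = sgn (b + c) in (0, s, s, 0))"
| "vact (E N2) (a, b, c, d) = (let s = sgn (c + d) in (0, 0, s, s))"
| "vact (E N4) (a, b, c, d) = (let s = sgn (c - d) in (0, 0, s, - s))"

lemma node_all: "(\<forall>i. P i) \<longleftrightarrow> P N1 \<and> P N2 \<and> P N3 \<and> P N4"
  by (metis node.exhaust)

lemma ball_relators_d4:
  "(\<forall>r\<in>relators. P r) \<longleftrightarrow>
    (\<forall>i. P ([R i, R i], 0, [])) \<and> (\<forall>i. P ([E i, E i], 1, [E i])) \<and>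
    (\<forall>i. P ([R i, E i], 0, [E i])) \<and> (\<forall>i. P ([E i, R i], 0, [E i])) \<and>
    (\<forall>i j. i \<noteq> j \<and> \<not> adj i j \<longrightarrow> P ([R i, R j], 0, [R j, R i])) \<and>
    (\<forall>i j. i \<noteq> j \<and> \<not> adj i j \<longrightarrow> P ([E i, R j], 0, [R j, E i])) \<and>
    (\<forall>i j. i \<noteq> j \<and> \<not> adj i j \<longrightarrow> P ([E i, E j], 0, [E j, E i])) \<and>
    (\<forall>i j. adj i j \<longrightarrow> P ([R i, R j, R i], 0, [R j, R i, R j])) \<and>
    (\<forall>i j. adj i j \<longrightarrow> P ([R j, R i, E j], 0, [E i, E j])) \<and>
    (\<forall>i j. adj i j \<longrightarrow> P ([R i, E j, R i], 0, [R j, E i, R j]))"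
proof -
  have 1: "(\<forall>r\<in>{f i | i. True}. P r) \<longleftrightarrow> (\<forall>i. P (f i))" for f :: "node \<Rightarrow> _" by blast
  have 2: "(\<forall>r\<in>{f i j | i j. Q i j}. P r) \<longleftrightarrow> (\<forall>i j. Q i j \<longrightarrow> P (f i j))"
    for f :: "node \<Rightarrow> node \<Rightarrow> _" and Q by blast
  show ?thesis unfolding relators_d4gen_def by (simp only: ball_Un 1 2 conj_assoc)
qed

lemma vact_relator: "\<forall>(u, k, v)\<in>relators. foldr vact u x = foldr vact v x"
proof -
  obtain a b c d where x: "x = (a, b, c, d)" by (cases x)
  show ?thesis
    unfolding ball_relators_d4 by (simp add: x node_all adj_def Let_def) (simp add: sgn_if)
qed

section \<open>Action on half diagrams\<close>

text \<open>The quotient of the D4 monoid by \<open>R\<^sub>2 = R\<^sub>4\<close>, \<open>E\<^sub>2 = E\<^sub>4\<close> is the Brauer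
  monoid on four strands. It acts on half diagrams with labelled free ends, given by
  the partner of each of the four points. Closed loops give powers of \<open>\<delta>\<close>; joining two free
  ends adds the product of their labels to a counter, the last component of a state.\<close>

datatype strand = S1 | S2 | S3 | S4 | Lab int

type_synonym half = "strand \<times> strand \<times> strand \<times> strand"

fun partner :: "strand \<Rightarrow> half \<Rightarrow> strand" where
  "partner S1 (a, b, c, d) = a"
| "partner S2 (a, b, c, d) = b"
| "partner S3 (a, b, c, d) = c"
| "partner S4 (a, b, c, d) = d"
| "partner (Lab x) f = Lab x"

fun join :: "strand \<Rightarrow> strand \<Rightarrow> half \<Rightarrow> half" where
  "join S1 y (a, b, c, d) = (y, b, c, d)"
| "join S2 y (a, b, c, d) = (a, y, c, d)"
| "join S3 y (a, b, c, d) = (a, b, y, d)"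
| "join S4 y (a, b, c, d) = (a, b, c, y)"
| "join (Lab x) y f = f"

definition swap2 :: "strand \<Rightarrow> strand \<Rightarrow> strand \<Rightarrow> strand" where
  "swap2 p q x = (if x = p then q else if x = q then p else x)"

fun cross :: "strand \<Rightarrow> strand \<Rightarrow> half \<Rightarrow> half" where
  "cross p q (a, b, c, d) =
    (let f = (swap2 p q a, swap2 p q b, swap2 p q c, swap2 p q d)
     in join p (partner q f) (join q (partner p f) f))"

text \<open>If \<open>p\<close> and \<open>q\<close> are already joined, a loop closes, which
  \<open>loops\<close> counts. Otherwise their former partners are joined; \<open>join\<close> at a
  label does nothing, so a point joined to a free end just takes over its label.\<close>

definition cap :: "strand \<Rightarrow> strand \<Rightarrow> half \<Rightarrow> half" where
  "cap p q f = (if partner p f = q then f else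
    join q p (join p q (join (partner q f) (partner p f) (join (partner p f) (partner q f) f))))"

fun weight :: "strand \<Rightarrow> strand \<Rightarrow> int" where
  "weight (Lab x) (Lab y) = x * y"
| "weight _ _ = 0"

fun ends :: "node \<Rightarrow> strand \<times> strand" where
  "ends N1 = (S1, S2)"
| "ends N3 = (S2, S3)"
| "ends N2 = (S3, S4)"
| "ends N4 = (S3, S4)"

type_synonym state = "vec list \<times> half \<times> int"

fun dstep :: "d4gen \<Rightarrow> half \<times> int \<Rightarrow> half \<times> int" where
  "dstep (R i) (f, c) = (let (p, q) = ends i in (cross p q f, c))"
| "dstep (E i) (f, c) = (let (p, q) = ends i in
     (cap p q f, weight (partner p f) (partner q f) + c))"

fun loops :: "d4gen \<Rightarrow> half \<Rightarrow> int" where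
  "loops (R i) f = 0"
| "loops (E i) f = (let (p, q) = ends i in if partner p f = q then 1 else 0)"

text \<open>The 1 + 6 + 3 partial matchings of four points, with arbitrary labels at the unmatched
  ones.\<close>

inductive_set halves :: "half set" where
  "(Lab x, Lab y, Lab z, Lab w) \<in> halves"
| "(S2, S1, Lab x, Lab y) \<in> halves"
| "(S3, Lab x, S1, Lab y) \<in> halves"
| "(S4, Lab x, Lab y, S1) \<in> halves"
| "(Lab x, S3, S2, Lab y) \<in> halves"
| "(Lab x, S4, Lab y, S2) \<in> halves"
| "(Lab x, Lab y, S4, S3) \<in> halves"
| "(S2, S1, S4, S3) \<in> halves"
| "(S3, S4, S1, S2) \<in> halves"
| "(S4, S3, S2, S1) \<in> halves"

primrec dstate :: "d4gen list \<Rightarrow> half \<times> int \<Rightarrow> half \<times> int" where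
  "dstate [] s = s"
| "dstate (g # w) s = dstep g (dstate w s)"

primrec nloops :: "d4gen list \<Rightarrow> half \<times> int \<Rightarrow> int" where
  "nloops [] s = 0"
| "nloops (g # w) s = loops g (fst (dstate w s)) + nloops w s"

lemma dstep_halves:
  assumes "f \<in> halves"
  shows "fst (dstep g (f, c)) \<in> halves"
proof -
  obtain x y z w where f: "f = (x, y, z, w)" by (cases f)
  have "\<forall>i. fst (dstep (R i) (f, c)) \<in> halves \<and> fst (dstep (E i) (f, c)) \<in> halves"
    unfolding node_all using assms unfolding f
    by cases (simp_all add: swap2_def cap_def halves.intros)
  then show ?thesis by (cases g) auto
qed

lemma dstate_relator:
  assumes "f \<in> halves"
  shows "\<forall>(u, k, v)\<in>relators. dstate u (f, c) = dstate v (f, c) \<and>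
    nloops u (f, c) = k + nloops v (f, c)"
proof -
  obtain x y z w where f: "f = (x, y, z, w)" by (cases f)
  show ?thesis
    unfolding ball_relators_d4 node_all adj_def using assms unfolding f
    by cases (simp_all add: swap2_def cap_def)
qed

section \<open>Functionals from both actions\<close>

definition wstate :: "d4gen list \<Rightarrow> state \<Rightarrow> state" where
  "wstate w s = (map (foldr vact w) (fst s), dstate w (snd s))"

lemma dstate_append [simp]: "dstate (u @ v) s = dstate u (dstate v s)"
  by (induction u) simp_all

lemma nloops_append: "nloops (u @ v) s = nloops u (dstate v s) + nloops v s"
  by (induction u) simp_all

lemma wstate_append: "wstate (u @ v) s = wstate u (wstate v s)"
  by (simp add: wstate_def)

lemma dstate_halves: "fst s \<in> halves \<Longrightarrow> fst (dstate w s) \<in> halves"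
proof (induction w)
  case (Cons g w)
  then show ?case using dstep_halves[of "fst (dstate w s)" g "snd (dstate w s)"] by simp
qed simp

lemma wstate_relator:
  assumes "(u, k, v) \<in> relators" "fst (snd s) \<in> halves"
  shows "wstate (p @ u @ q) s = wstate (p @ v @ q) s"
    and "nloops (p @ u @ q) (snd s) = k + nloops (p @ v @ q) (snd s)"
proof -
  have v: "foldr vact u x = foldr vact v x" for x using vact_relator assms(1) by fast
  obtain f c where fc: "dstate q (snd s) = (f, c)" by (cases "dstate q (snd s)")
  with dstate_halves[OF assms(2), of q] have "f \<in> halves" by simp
  with dstate_relator[of f c] assms(1)
  have "dstate u (f, c) = dstate v (f, c)" "nloops u (f, c) = k + nloops v (f, c)" by fast+
  then show "wstate (p @ u @ q) s = wstate (p @ v @ q) s"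
    and "nloops (p @ u @ q) (snd s) = k + nloops (p @ v @ q) (snd s)"
    by (simp_all add: wstate_def v fc nloops_append)
qed

text \<open>On the free module over the states, \<open>w\<close> sends \<open>s\<close> to
  \<open>dpow (nloops w (snd s))\<close> times \<open>wstate w s\<close>; this is the matrix
  coefficient at \<open>s\<close> and \<open>z\<close>.\<close>

definition state_form :: "state \<Rightarrow> state \<Rightarrow> d4gen list \<Rightarrow> laurent" where
  "state_form s z w = (if wstate w s = z then dpow (nloops w (snd s)) else 0)"

lemma lin_ext_state_form:
  assumes "x \<in> I_D4" "fst (snd s) \<in> halves"
  shows "lin_ext (state_form s z) x = 0"
proof (rule lin_ext_gen_ideal[OF _ relators_FA])
  show "x \<in> gen_ideal ((\<lambda>(u, k, v). fsub (wd u) (mon k v)) ` relators)"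
    using assms(1) by (simp flip: rel_ideal_d4 add: rel_ideal_def)
next
  fix a :: "d4gen falg" and p q
  assume "a \<in> (\<lambda>(u, k, v). fsub (wd u) (mon k v)) ` relators"
  then obtain u k v where r: "(u, k, v) \<in> relators" and a: "a = fsub (wd u) (mon k v)" by auto
  note w = wstate_relator[OF r assms(2), of p q]
  show "lin_ext (\<lambda>w. state_form s z (p @ w @ q)) a = 0"
    unfolding a
    by (simp add: lin_ext_fsub) (simp add: mon_def lin_ext_smul state_form_def w dpow_mult)
qed

lemma wstate_cong:
  assumes "fsub (mon k u) (mon l v) \<in> I_D4" "fst (snd s) \<in> halves"
  shows "wstate u s = wstate v s"
proof (rule ccontr)
  assume "wstate u s \<noteq> wstate v s"
  \<comment> \<open>The functional sees only the first monomial and returns a power of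
    \<open>delta\<close>, which is not zero.\<close>
  then have "lin_ext (state_form s (wstate u s)) (fsub (mon k u) (mon l v)) =
      dpow (k + nloops u (snd s))"
    by (simp add: lin_ext_fsub) (simp add: mon_def lin_ext_smul state_form_def dpow_mult)
  with lin_ext_state_form[OF assms] show False by simp
qed

text \<open>When the states are distinct, the functionals \<open>state_form s\<close> at these
  states are dual to the words of \<open>N\<close> up to powers of \<open>delta\<close>, which are
  units.\<close>

lemma lincomb_independent:
  assumes "distinct (map (\<lambda>w. wstate w s) N)" "fst (snd s) \<in> halves"
    and "lincomb (length N) c (\<lambda>i. wd (N ! i)) \<in> I_D4" and i: "i < length N"
  shows "c i = 0"
proof -
  have "wstate (N ! j) s = wstate (N ! i) s \<longleftrightarrow> j = i" if "j < length N" for j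
    using assms(1) i that by (auto simp: distinct_conv_nth)
  then have "(\<Sum>j<length N. c j * state_form s (wstate (N ! i) s) (N ! j)) =
      (\<Sum>j<length N. if j = i then c i * dpow (nloops (N ! i) (snd s)) else 0)"
    by (intro sum.cong) (auto simp: state_form_def)
  with i lin_ext_state_form[OF assms(3,2), of "wstate (N ! i) s"]
  have "c i * dpow (nloops (N ! i) (snd s)) = 0"
    by (simp add: lin_ext_lincomb)
  then have "c i * dpow (nloops (N ! i) (snd s)) * dpow (- nloops (N ! i) (snd s)) = 0" by simp
  then show ?thesis by (simp only: mult.assoc dpow_mult) simp
qed

section \<open>Finite checks on explicit words\<close>

fun phi_word :: "g2gen \<Rightarrow> d4gen list" where
  "phi_word r0 = [R N1, R N2, R N4]"
| "phi_word r1 = [R N3]"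
| "phi_word e0 = [E N1, E N2, E N4]"
| "phi_word e1 = [E N3]"

text \<open>The labels are such that the three ways of joining all four free ends in pairs have
  different weights.\<close>

definition base_state :: state where
  "base_state = ([(1, 0, 0, 0), (0, 1, 0, 0)], (Lab 0, Lab 1, Lab 2, Lab 3), 0)"

text \<open>Fixed by the Weyl group, so it sees only the admissible set of an element.\<close>

definition blank_state :: state where
  "blank_state = ([], (Lab 0, Lab 0, Lab 0, Lab 0), 0)"

lemma phi_states_distinct:
  "distinct (map (\<lambda>w. wstate (concat (map phi_word w)) base_state) g2_words)"
  by code_simp

definition sig_word :: "d4gen list \<Rightarrow> d4gen list" where
  "sig_word w = map sig_gen w"

text \<open>The invariants are not equivariant under \<open>\<sigma>\<close>; comparing those of \<open>w\<close>, \<open>\<sigma>(w)\<close> and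
  \<open>\<sigma>\<^sup>2(w)\<close> exploits all three triality twists at once.\<close>

definition sig_fixed :: "state \<Rightarrow> d4gen list \<Rightarrow> bool" where
  "sig_fixed s w \<longleftrightarrow> wstate (sig_word w) s = wstate w s \<and>
    wstate (sig_word (sig_word w)) s = wstate w s"

text \<open>One word for each \<sigma>-stable admissible set: the empty set, the 3 fixed positive
  roots and the 3 quadruples. No orthogonal pair is stable.\<close>

definition inv_tops :: "d4gen list list" where
  "inv_tops = [[], [E N3], [R N1, R N2, R N4, E N3], [R N3, R N1, R N2, R N4, E N3],
    [E N1, E N2, E N4], [R N3, E N1, E N2, E N4], [R N1, R N3, E N1, E N2, E N4]]"

lemma sig_fixed_tops: "\<forall>u\<in>set d4_tops. sig_fixed blank_state u \<longrightarrow> u \<in> set inv_tops"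
  by code_simp

text \<open>The 12 elements of the dihedral group, spelled as they occur in
  \<open>weyl_words\<close>.\<close>

definition inv_weyl :: "d4gen list list" where
  "inv_weyl = [[], [R N3], [R N4, R N2, R N1], [R N4, R N2, R N1, R N3],
    [R N3, R N4, R N2, R N1], [R N3, R N4, R N2, R N1, R N3],
    [R N1, R N2, R N3, R N4, R N3, R N2, R N1], [R N1, R N2, R N3, R N4, R N3, R N2, R N1, R N3],
    [R N3, R N1, R N2, R N3, R N4, R N3, R N2, R N1],
    [R N3, R N1, R N2, R N3, R N4, R N3, R N2, R N1, R N3],
    [R N4, R N3, R N1, R N2, R N3, R N4, R N1, R N3, R N2, R N3, R N1],
    [R N4, R N3, R N1, R N2, R N3, R N4, R N1, R N3, R N2, R N1, R N3, R N1]]"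

definition sig_fixed_vec :: "d4gen list \<Rightarrow> vec \<Rightarrow> bool" where
  "sig_fixed_vec w x \<longleftrightarrow> (let y = foldr vact w x in
    foldr vact (sig_word w) x = y \<and> foldr vact (sig_word (sig_word w)) x = y)"

text \<open>An evaluation of 4 * 192 words at the two vectors of \<open>base_state\<close>. Top
  words of quadruples are handled by \<open>triple_bottom\<close> instead.\<close>

lemma sig_fixed_weyl:
  "\<forall>u\<in>set [[], [E N3], [R N1, R N2, R N4, E N3], [R N3, R N1, R N2, R N4, E N3]].
    \<forall>g\<in>set weyl_words.
      sig_fixed_vec (u @ g) (1, 0, 0, 0) \<and> sig_fixed_vec (u @ g) (0, 1, 0, 0) \<longrightarrow> g \<in> set inv_weyl"
  by code_simp

lemma weyl_words_blank:
  "\<forall>g\<in>set weyl_words. wstate g blank_state = blank_state \<and>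
    wstate (sig_word g) blank_state = blank_state \<and>
    wstate (sig_word (sig_word g)) blank_state = blank_state"
  by code_simp

subsection \<open>The homomorphism and the automorphism on words\<close>

interpretation phi: word_subst phi_gen phi_word
proof
  show "phi_gen g = wd (phi_word g)" for g by (cases g) simp_all
qed

interpretation sigma: word_subst "\<lambda>g. wd [sig_gen g]" "\<lambda>g. [sig_gen g]"
  by unfold_locales simp

lemma sigma_fa_mon: "sigma_fa (mon k w) = mon k (sig_word w)"
proof -
  have "concat (map (\<lambda>g. [sig_gen g]) w) = sig_word w"
    by (induction w) (simp_all add: sig_word_def)
  then show ?thesis by (simp add: sigma_fa_def sigma.subst_mon)
qed

abbreviation leaves :: "d4gen brm \<Rightarrow> d4gen brm" where
  "leaves x \<equiv> rr N1 (rr N2 (rr N4 x))"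

lemma leaves_rules:
  "leaves (ee N3 (leaves x)) = refl2 N2 N4 (ee N1 (refl2 N2 N4 x))"
  "leaves (rr N3 (leaves x)) = refl2 N2 N4 (rr N1 (refl2 N2 N4 x))"
  "refl2 N2 N4 (ee N3 x) = ee N3 (refl2 N2 N4 x)"
  "refl2 N2 N4 (rr N3 x) = rr N3 (refl2 N2 N4 x)"
  "refl2 N2 N4 (refl2 N2 N4 x) = x"
  by (simp_all add: leaves_ee3_leaves leaves_rr3_leaves refl2_ee refl2_rr refl2_refl2)

text \<open>Each leaf reflection is absorbed by its \<open>ee\<close> and exchanges
  \<open>ee N3\<close> with \<open>rr N3\<close>; after three leaves \<open>rr N3\<close>
  remains.\<close>

lemma phi_ee0_ee1_rr0:
  "ee N1 (ee N2 (ee N4 (ee N3 (leaves x)))) = ee N1 (ee N2 (ee N4 (rr N3 x)))"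
proof -
  have r: "ee a (ee N3 (rr a y)) = ee a (rr N3 y)" if "a \<noteq> N3" for a y
    using ee_rr_rr[of a N3 "rr a y"] that by simp
  have "ee N1 (ee N2 (ee N4 (ee N3 (leaves x)))) =
      ee N1 (ee N2 (ee N4 (ee N3 (rr N4 (rr N2 (rr N1 x))))))"
    by (simp add: leaf_order)
  also have "\<dots> = ee N1 (ee N2 (ee N4 (rr N3 (rr N2 (rr N1 x)))))"
    by (simp add: r)
  also have "\<dots> = ee N1 (ee N4 (ee N2 (rr N3 (rr N2 (rr N1 x)))))"
    by (simp add: leaf_order)
  also have "\<dots> = ee N1 (ee N4 (ee N2 (ee N3 (rr N1 x))))"
    by (simp add: ee_rr_rr)
  also have "\<dots> = ee N4 (ee N2 (ee N1 (ee N3 (rr N1 x))))"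
    by (simp add: leaf_order)
  also have "\<dots> = ee N4 (ee N2 (ee N1 (rr N3 x)))"
    by (simp add: r)
  also have "\<dots> = ee N1 (ee N2 (ee N4 (rr N3 x)))"
    by (simp add: leaf_order)
  finally show ?thesis .
qed

lemma phi_relators:
  "\<forall>(u, k, v)\<in>relators. acts (phi.hw u) x = sh k (acts (phi.hw v) x)"
proof -
  have 1: "leaves (ee N3 (ee N1 (ee N2 (ee N4 x)))) = rr N3 (ee N1 (ee N2 (ee N4 x)))"
    by (simp add: ee3_ee leaf_order rr_rr3_ee_ee_ee rr_rr3_ee_ee)
  have "ee N3 (leaves (ee N3 (leaves (ee N3 x)))) =
      ee N3 (refl2 N2 N4 (ee N1 (refl2 N2 N4 (ee N3 x))))"
    by (simp only: leaves_rules(1))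
  also have "\<dots> = refl2 N2 N4 (ee N3 (ee N1 (ee N3 (refl2 N2 N4 x))))"
    by (simp only: leaves_rules(3))
  also have "\<dots> = ee N3 x" by (simp add: ee_ee_ee leaves_rules(3,5))
  finally have 2: "ee N3 (leaves (ee N3 (leaves (ee N3 x)))) = ee N3 x" .
  have 3: "ee N3 (leaves (ee N3 (leaves (rr N3 x)))) = ee N3 (leaves (rr N3 (leaves x)))"
    by (simp add: ee3_leaves_ee3 leaf_order)
  have "ee N1 (ee N2 (ee N4 (rr N3 (ee N1 (ee N2 (ee N4 x)))))) =
      ee N2 (ee N4 (ee N1 (rr N3 (ee N1 (ee N2 (ee N4 x))))))"
    by (simp add: leaf_order)
  also have "\<dots> = ee N2 (ee N4 (ee N1 (ee N2 (ee N4 x))))" by (simp add: ee_rr_ee)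
  also have "\<dots> = sh 2 (ee N1 (ee N2 (ee N4 x)))" by (simp add: leaf_order)
  finally have 4: "ee N1 (ee N2 (ee N4 (rr N3 (ee N1 (ee N2 (ee N4 x)))))) =
      sh 2 (ee N1 (ee N2 (ee N4 x)))" .
  have "leaves (ee N3 (leaves (ee N3 x))) = refl2 N2 N4 (ee N1 (ee N3 (refl2 N2 N4 x)))"
    by (simp only: leaves_rules)
  also have "\<dots> = refl2 N2 N4 (rr N3 (rr N1 (ee N3 (refl2 N2 N4 x))))"
    by (simp add: rr_rr_ee)
  also have "\<dots> = rr N3 (refl2 N2 N4 (rr N1 (refl2 N2 N4 (ee N3 x))))"
    by (simp only: leaves_rules)
  also have "\<dots> = rr N3 (leaves (rr N3 (leaves (ee N3 x))))" by (simp only: leaves_rules(2))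
  finally have 5: "rr N3 (leaves (ee N3 (leaves (ee N3 x)))) = leaves (rr N3 (leaves (ee N3 x)))"
    by simp
  \<comment> \<open>Up to conjugation by \<open>refl2 N2 N4\<close>, the square of the image of
    \<open>r1 r0\<close> is \<open>R N3\<close> times \<open>R N1\<close>. Its cube is trivial by
    the braid relation.\<close>
  have "rr N3 (leaves (rr N3 (leaves y))) = refl2 N2 N4 (rr N3 (rr N1 (refl2 N2 N4 y)))" for y
    by (simp only: leaves_rules(2) leaves_rules(4))
  then have "rr N3 (leaves (rr N3 (leaves (rr N3 (leaves (rr N3 (leaves (rr N3 (leaves
      (rr N3 (leaves x))))))))))) = refl2 N2 N4 (rr N3 (rr N1 (rr N3 (rr N1 (rr N3 (rr N1
        (refl2 N2 N4 x)))))))"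
    by (simp add: leaves_rules(5))
  also have "\<dots> = x" by (simp add: rr_braid[of N1 N3] leaves_rules(5))
  finally have 6: "rr N3 (leaves (rr N3 (leaves (rr N3 (leaves (rr N3 (leaves (rr N3 (leaves
      (rr N3 (leaves x))))))))))) = x" .
  have 7: "ee N1 (ee N2 (ee N4 (leaves x))) = ee N1 (ee N2 (ee N4 x))"
    by (simp add: ee_rr_leaf_commute)
  show ?thesis
    unfolding relators_g2gen_def
    by (simp add: 1 2 3 4 5 6 7 phi_ee0_ee1_rr0 del: rr_rr) (simp add: leaf_order)
qed

lemma phi_gen_ideal:
  assumes "x \<in> I_G2" shows "subst phi_gen x \<in> I_D4"
proof -
  have "subst phi_gen a \<in> I_D4"
    if "a \<in> (\<lambda>(u, k, v). fsub (wd u) (mon k v)) ` relators" for a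
  proof -
    from that obtain u k v where r: "(u, k, v) \<in> relators" and a: "a = fsub (wd u) (mon k v)"
      by auto
    from r phi_relators[of munit]
    have "sh 0 (acts (phi.hw u) munit) = sh k (acts (phi.hw v) munit)" by auto
    then have "fsub (mon 0 (phi.hw u)) (mon k (phi.hw v)) \<in> I_D4"
      by (simp only: brm_eq_iff rel_ideal_d4)
    then show ?thesis by (simp add: a subst_fsub phi.word_img_eq phi.subst_mon)
  qed
  with assms show ?thesis
    unfolding rel_ideal_g2[symmetric] rel_ideal_def[where 'g = g2gen] I_D4_def
    by (rule phi.subst_gen_ideal[OF _ relators_FA])
qed

lemma sig_gen_relators: "\<forall>(u, k, v)\<in>relators. (sig_word u, k, sig_word v) \<in> relators"
proof -
  have sig: "sig i = sig j \<longleftrightarrow> i = j" for i j by (cases i; cases j) simp_all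
  have "sig i = N3 \<longleftrightarrow> i = N3" for i by (cases i) simp_all
  then have adj: "adj (sig i) (sig j) \<longleftrightarrow> adj i j" for i j by (simp add: adj_def sig)
  \<comment> \<open>A triviality that, split by \<open>ball_relators_d4\<close>, yields the
    membership facts of all ten families.\<close>
  have "\<forall>r\<in>relators. r \<in> (relators :: (d4gen list \<times> int \<times> d4gen list) set)" by blast
  note mem = this[unfolded ball_relators_d4]
  show ?thesis
    unfolding ball_relators_d4 sig_word_def prod.case list.map sig_gen.simps
    using mem by (simp add: sig adj)
qed

lemma sigma_mon_ideal:
  assumes "fsub (mon k u) (mon l v) \<in> I_D4"
  shows "fsub (mon k (sig_word u)) (mon l (sig_word v)) \<in> I_D4"
proof -
  have I: "I_D4 = gen_ideal ((\<lambda>(u, k, v). fsub (wd u) (mon k v)) ` relators)"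
    by (simp flip: rel_ideal_d4 add: rel_ideal_def)
  have "sigma_fa a \<in> I_D4"
    if "a \<in> (\<lambda>(u, k, v). fsub (wd u) (mon k v)) ` relators" for a
  proof -
    from that obtain u k v where r: "(u, k, v) \<in> relators" and a: "a = fsub (wd u) (mon k v)"
      by auto
    from r sig_gen_relators have "(sig_word u, k, sig_word v) \<in> relators" by auto
    then have "fsub (wd (sig_word u)) (mon k (sig_word v)) \<in> I_D4"
      unfolding rel_ideal_d4[symmetric] rel_ideal_def by (force intro: gi_gen)
    then show ?thesis
      using sigma_fa_mon[of 0 u] sigma_fa_mon[of k v]
      by (simp add: a sigma_fa_def subst_fsub)
  qed
  then have "sigma_fa (fsub (mon k u) (mon l v)) \<in> I_D4"
    unfolding sigma_fa_def I by (rule sigma.subst_gen_ideal[OF assms[unfolded I] relators_FA])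
  then show ?thesis
    using sigma_fa_mon[of k u] sigma_fa_mon[of l v] by (simp add: sigma_fa_def subst_fsub)
qed

subsection \<open>Invariant monomials\<close>

lemma rr_eq_iff: "rr i x = rr i y \<longleftrightarrow> x = y"
  by (metis rr_rr)

lemma inv_weyl_phi:
  assumes "g \<in> set inv_weyl"
  shows "\<exists>v. acts g x = acts (phi.hw v) x"
proof -
  have a: "rr N4 (rr N2 (rr N1 x)) = leaves x" for x by (simp add: leaf_order)
  have "rr N3 (rr N4 (rr N3 y)) = rr N4 (rr N3 (rr N4 y))" for y by (rule rr_braid) simp
  then have b: "rr N1 (rr N2 (rr N3 (rr N4 (rr N3 (rr N2 (rr N1 x)))))) =
      leaves (rr N3 (leaves x))" for x
    by (simp add: leaf_order)
  have c: "rr N4 (rr N3 (rr N1 (rr N2 (rr N3 (rr N4 (rr N1 (rr N3 (rr N2 (rr N3 (rr N1 x)))))))))) =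
      leaves (rr N3 (leaves (rr N3 (leaves x))))" for x
    by (simp add: cosets4_rules rr_eq_iff) (simp add: cosets3_rules rr_eq_iff)
  have d: "rr N4 (rr N3 (rr N1 (rr N2 (rr N3 (rr N4 (rr N1 (rr N3 (rr N2 (rr N1 (rr N3
      (rr N1 x))))))))))) =
      leaves (rr N3 (leaves (rr N3 (leaves (rr N3 x)))))" for x
    using c[of "rr N3 x"] rr_braid[of N1 N3 x] by simp
  \<comment> \<open>Spellings in \<open>r0\<close> and \<open>r1\<close>, in the order of
    \<open>inv_weyl\<close>.\<close>
  define vs where "vs = [[], [r1], [r0], [r0, r1], [r1, r0], [r1, r0, r1], [r0, r1, r0],
    [r0, r1, r0, r1], [r1, r0, r1, r0], [r1, r0, r1, r0, r1], [r0, r1, r0, r1, r0],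
    [r0, r1, r0, r1, r0, r1]]"
  have "list_all2 (\<lambda>g v. acts g x = acts (phi.hw v) x) inv_weyl vs"
    by (simp add: inv_weyl_def vs_def a b c d)
  with assms show ?thesis by (auto simp: list_all2_conv_all_nth in_set_conv_nth)
qed

text \<open>To the right of \<open>E N1\<close>, \<open>E N2\<close>, \<open>E N4\<close>, a leaf
  reflection is absorbed or exchanges \<open>rr N3\<close> with \<open>ee N3\<close>. Every Weyl
  word thus shrinks to the identity, \<open>rr N3\<close> or \<open>ee N3\<close>.\<close>

lemma triple_bottom:
  "\<exists>v. \<forall>x. acts ([E N1, E N2, E N4] @ map R is) x = acts (phi.hw (e0 # v)) x"
proof -
  let ?q = "\<lambda>x. ee N1 (ee N2 (ee N4 x))"
  have r: "ee a (ee N3 (rr a y)) = ee a (rr N3 y)" if "a \<noteq> N3" for a y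
    using ee_rr_rr[of a N3 "rr a y"] that by simp
  have q1: "?q y = ee N4 (ee N2 (ee N1 y))" and q2: "?q y = ee N1 (ee N4 (ee N2 y))" for y
    by (simp_all add: leaf_order)
  have "?q (rr N3 (rr a y)) = ?q (ee N3 y) \<and> ?q (ee N3 (rr a y)) = ?q (rr N3 y)"
    if "a \<noteq> N3" for a y
  proof (cases a)
    case N1
    then show ?thesis unfolding q1 by (simp add: ee_rr_rr r)
  next
    case N2
    then show ?thesis unfolding q2 by (simp add: ee_rr_rr r)
  next
    case N4
    then show ?thesis by (simp add: ee_rr_rr r)
  qed (use that in simp)
  moreover have "?q (rr a y) = ?q y" if "a \<noteq> N3" for a y
    using that by (cases a) (simp_all add: ee_rr_leaf_commute)
  ultimately have leaf: "?q (rr a y) = ?q y" "?q (rr N3 (rr a y)) = ?q (ee N3 y)"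
    "?q (ee N3 (rr a y)) = ?q (rr N3 y)" if "a \<noteq> N3" for a y
    using that by blast+
  have "\<exists>v\<in>{[], [r1], [e1]}. \<forall>x. ?q (acts (map R is) x) = ?q (acts (phi.hw v) x)"
  proof (induction "is" rule: rev_induct)
    case Nil
    show ?case by (rule bexI[of _ "[]"]) simp_all
  next
    case (snoc i "is")
    then obtain v where v: "v \<in> {[], [r1], [e1]}"
      "\<And>x. ?q (acts (map R is) x) = ?q (acts (phi.hw v) x)" by blast
    have "\<exists>v'\<in>{[], [r1], [e1]}. \<forall>x. ?q (acts (phi.hw v) (rr i x)) = ?q (acts (phi.hw v') x)"
      using v(1) leaf[of i] by (cases "i = N3") (elim insertE emptyE; simp)+
    with v(2) show ?case by simp
  qed
  then obtain v where "\<forall>x. ?q (acts (map R is) x) = ?q (acts (phi.hw v) x)" by blast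
  then show ?thesis by (intro exI[of _ v]) simp
qed

lemma weyl_map_R: "z \<in> weyl \<Longrightarrow> \<exists>is. z = acts (map R is) munit"
proof (induction rule: parabolic.induct)
  case parabolic_munit
  show ?case by (rule exI[of _ "[]"]) simp
next
  case (parabolic_rr z i)
  then obtain "is" where "z = acts (map R is) munit" by blast
  then show ?case by (intro exI[of _ "i # is"]) simp
qed

lemma invariant_monomial:
  assumes inv: "fsub (mon k (sig_word w)) (mon k w) \<in> I_D4"
  shows "\<exists>l v. acts w munit = sh l (acts (phi.hw v) munit)"
proof -
  obtain j u z where u: "u \<in> set d4_tops" and z: "z \<in> weyl"
    and w: "acts w munit = sh j (acts u z)"
    using d4_normal_acts[of w] by (auto simp: d4_normal_def)
  obtain g where g: "g \<in> set weyl_words" "z = acts g munit" by (rule weyl_cases[OF z])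
  have "sh 0 (acts w munit) = sh j (acts (u @ g) munit)" by (simp add: w g)
  then have eq: "fsub (mon 0 w) (mon j (u @ g)) \<in> I_D4"
    by (simp only: brm_eq_iff rel_ideal_d4)
  \<comment> \<open>Invariance passes from \<open>w\<close> to its normal form because \<sigma>
    preserves the ideal and states depend only on classes modulo it.\<close>
  have fixed: "sig_fixed s (u @ g)" if s: "fst (snd s) \<in> halves" for s
  proof -
    note s = s and eq1 = sigma_mon_ideal[OF eq]
    have "wstate w s = wstate (u @ g) s" by (rule wstate_cong[OF eq s])
    moreover have "wstate (sig_word w) s = wstate (sig_word (u @ g)) s"
      by (rule wstate_cong[OF eq1 s])
    moreover have "wstate (sig_word (sig_word w)) s = wstate (sig_word (sig_word (u @ g))) s"
      by (rule wstate_cong[OF sigma_mon_ideal[OF eq1] s])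
    moreover have "wstate (sig_word w) s = wstate w s" by (rule wstate_cong[OF inv s])
    moreover have "wstate (sig_word (sig_word w)) s = wstate (sig_word w) s"
      by (rule wstate_cong[OF sigma_mon_ideal[OF inv] s])
    ultimately show ?thesis by (simp add: sig_fixed_def)
  qed
  have "sig_fixed blank_state (u @ g)"
    by (rule fixed) (simp add: blank_state_def halves.intros)
  \<comment> \<open>\<open>g\<close> and its twists fix \<open>blank_state\<close>, which leaves a
    condition on \<open>u\<close> alone.\<close>
  then have "sig_fixed blank_state u"
    using weyl_words_blank g(1) by (auto simp: sig_fixed_def sig_word_def wstate_append)
  with u sig_fixed_tops have "u \<in> set inv_tops" by blast
  then consider
      (root) "u \<in> set [[], [E N3], [R N1, R N2, R N4, E N3], [R N3, R N1, R N2, R N4, E N3]]"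
    | (triple) "u \<in> set [[E N1, E N2, E N4], [R N3, E N1, E N2, E N4],
        [R N1, R N3, E N1, E N2, E N4]]"
    by (auto simp: inv_tops_def)
  then obtain v where "acts (u @ g) munit = acts (phi.hw v) munit"
  proof cases
    case root
    have "sig_fixed base_state (u @ g)"
      by (rule fixed) (simp add: base_state_def halves.intros)
    then have "sig_fixed_vec (u @ g) (1, 0, 0, 0)" "sig_fixed_vec (u @ g) (0, 1, 0, 0)"
      by (simp_all add: sig_fixed_def sig_fixed_vec_def wstate_def base_state_def)
    with root g(1) sig_fixed_weyl have "g \<in> set inv_weyl" by blast
    then obtain v where v: "acts g munit = acts (phi.hw v) munit" using inv_weyl_phi by blast
    from root have "\<exists>v'. \<forall>x. acts u x = acts (phi.hw v') x"
      using exI[of "\<lambda>v'. \<forall>x. acts u x = acts (phi.hw v') x" "[]"]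
        exI[of "\<lambda>v'. \<forall>x. acts u x = acts (phi.hw v') x" "[e1]"]
        exI[of "\<lambda>v'. \<forall>x. acts u x = acts (phi.hw v') x" "[r0, e1]"]
        exI[of "\<lambda>v'. \<forall>x. acts u x = acts (phi.hw v') x" "[r1, r0, e1]"]
      by auto
    then obtain v' where "\<And>x. acts u x = acts (phi.hw v') x" by blast
    then have "acts (u @ g) munit = acts (phi.hw (v' @ v)) munit" by (simp add: v)
    then show thesis by (rule that)
  next
    case triple
    obtain "is" where "is": "z = acts (map R is) munit" using weyl_map_R[OF z] by blast
    obtain v where v: "\<And>x. acts ([E N1, E N2, E N4] @ map R is) x = acts (phi.hw (e0 # v)) x"
      using triple_bottom by blast
    \<comment> \<open>The word \<open>[e1]\<close> covers the third case: \<open>ee N3\<close> acts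
      as \<open>rr N1\<close> after \<open>rr N3\<close> on anything that starts with
      \<open>ee N1\<close>.\<close>
    from triple have "\<exists>v'. \<forall>x. acts u x = acts (phi.hw v') (acts [E N1, E N2, E N4] x)"
      using exI[of "\<lambda>v'. \<forall>x. acts u x = acts (phi.hw v') (acts [E N1, E N2, E N4] x)" "[]"]
        exI[of "\<lambda>v'. \<forall>x. acts u x = acts (phi.hw v') (acts [E N1, E N2, E N4] x)" "[r1]"]
        exI[of "\<lambda>v'. \<forall>x. acts u x = acts (phi.hw v') (acts [E N1, E N2, E N4] x)" "[e1]"]
      by (auto simp: ee3_ee)
    then obtain v' where "\<And>x. acts u x = acts (phi.hw v') (acts [E N1, E N2, E N4] x)" by blast
    then have "acts (u @ g) munit = acts (phi.hw (v' @ e0 # v)) munit"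
      using v[of munit] by (simp add: g(2)[symmetric] "is")
    then show thesis by (rule that)
  qed
  then show ?thesis using w g(2) by auto
qed

subsection \<open>The isomorphism\<close>

lemma S_D4_FA: "y \<in> S_D4 \<Longrightarrow> y \<in> FA"
  unfolding S_D4_def
  by (induction rule: gen_subalg.induct) (auto simp: inv_BrM_reps_def BrM_reps_def)

text \<open>\<sigma> only permutes the commuting factors of each image.\<close>

lemma phi_gen_S_D4: "phi_gen g \<in> S_D4"
proof -
  have "fsub (mon 0 (sig_word (phi_word g))) (mon 0 (phi_word g)) \<in> I_D4"
    unfolding rel_ideal_d4[symmetric] brm_eq_iff[symmetric]
    by (cases g) (simp_all add: sig_word_def leaf_order)
  moreover have "phi_gen g = mon 0 (phi_word g)" by (simp add: phi.s_eq)
  moreover have "mon 0 (phi_word g) \<in> BrM_reps" unfolding BrM_reps_def mon_def by blast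
  ultimately have "phi_gen g \<in> inv_BrM_reps"
    by (simp add: inv_BrM_reps_def sigma_fa_mon del: mon_0)
  then show ?thesis unfolding S_D4_def by (rule gs_gen)
qed

lemma subst_phi_S_D4: "x \<in> FA \<Longrightarrow> subst phi_gen x \<in> S_D4"
proof (induction rule: FA_induct)
  case zero
  have "smul 0 fone \<in> S_D4" unfolding S_D4_def by (intro gs_smul gs_one)
  also have "smul 0 fone = (fzero :: d4gen falg)" by (simp add: smul_def fzero_def)
  finally show ?case by simp
next
  case (add x c w)
  have "word_img phi_gen w \<in> S_D4"
  proof (induction w)
    case Nil
    show ?case unfolding S_D4_def word_img_def by (simp add: gs_one)
  next
    case (Cons g w)
    then show ?case using phi_gen_S_D4[of g] unfolding S_D4_def word_img_def by (simp add: gs_mul)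
  qed
  with add show ?case
    unfolding S_D4_def by (simp add: subst_fadd subst_smul gs_add gs_smul)
qed

text \<open>Invariant monomials are images by \<open>invariant_monomial\<close>, and the images
  modulo the ideal form a subalgebra.\<close>

lemma phi_onto_S_D4:
  assumes "y \<in> S_D4"
  shows "\<exists>x\<in>FA. fsub (subst phi_gen x) y \<in> I_D4"
  using assms unfolding S_D4_def
proof (induction rule: gen_subalg.induct)
  case (gs_gen y)
  then obtain k w where y: "y = mon k w" and inv: "fsub (mon k (sig_word w)) (mon k w) \<in> I_D4"
    by (auto simp: inv_BrM_reps_def BrM_reps_def sigma_fa_mon simp flip: mon_def)
  from invariant_monomial[OF inv] obtain l v
    where "acts w munit = sh l (acts (phi.hw v) munit)" by blast
  then have "sh (k + l) (acts (phi.hw v) munit) = sh k (acts w munit)" by simp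
  then have "fsub (mon (k + l) (phi.hw v)) (mon k w) \<in> I_D4"
    by (simp only: brm_eq_iff rel_ideal_d4)
  then show ?case by (intro bexI[of _ "mon (k + l) v"]) (simp_all add: y phi.subst_mon)
next
  case gs_one
  show ?case
    by (rule bexI[of _ fone]) (simp_all add: phi.word_img_eq I_D4_def gi_zero)
next
  case (gs_add y y')
  then obtain x x' where "x \<in> FA" "fsub (subst phi_gen x) y \<in> I_D4"
    "x' \<in> FA" "fsub (subst phi_gen x') y' \<in> I_D4" by blast
  then show ?case unfolding I_D4_def
    by (intro bexI[of _ "fadd x x'"]) (simp_all add: subst_fadd gen_ideal_fsub_fadd)
next
  case (gs_smul y c)
  then obtain x where "x \<in> FA" "fsub (subst phi_gen x) y \<in> I_D4" by blast
  then show ?case unfolding I_D4_def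
    by (intro bexI[of _ "smul c x"]) (simp_all add: subst_smul gen_ideal_fsub_smul)
next
  case (gs_mul y y')
  then obtain x x' where "x \<in> FA" "fsub (subst phi_gen x) y \<in> I_D4"
    "x' \<in> FA" "fsub (subst phi_gen x') y' \<in> I_D4" by blast
  moreover have "y' \<in> FA" using gs_mul S_D4_FA by (simp add: S_D4_def)
  ultimately show ?case unfolding I_D4_def
    by (intro bexI[of _ "fmul x x'"]) (simp_all add: phi.subst_fmul gen_ideal_fsub_fmul)
qed

definition g2_basis :: "nat \<Rightarrow> g2gen falg" where
  "g2_basis i = wd (g2_words ! i)"

lemma g2_span:
  assumes "x \<in> FA" shows "\<exists>c. fsub x (lincomb 39 c g2_basis) \<in> I_G2"
  using FA_span[OF assms g2_normal_form]
  by (simp add: length_g2_words rel_ideal_g2 g2_basis_def[abs_def])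

lemma subst_phi_lincomb:
  "subst phi_gen (lincomb n c g2_basis) = lincomb n c (\<lambda>i. subst phi_gen (g2_basis i))"
  by (rule subst_lincomb) (simp add: g2_basis_def)

lemma phi_basis_independent:
  assumes "lincomb 39 c (\<lambda>i. subst phi_gen (g2_basis i)) \<in> I_D4" "i < 39"
  shows "c i = 0"
proof (rule lincomb_independent)
  let ?N = "map phi.hw g2_words"
  show "distinct (map (\<lambda>w. wstate w base_state) ?N)"
    using phi_states_distinct by (simp add: comp_def)
  show "fst (snd base_state) \<in> halves" by (simp add: base_state_def halves.intros)
  have "lincomb (length ?N) c (\<lambda>i. wd (?N ! i)) = lincomb 39 c (\<lambda>i. subst phi_gen (g2_basis i))"
    by (simp add: lincomb_def length_g2_words g2_basis_def phi.word_img_eq)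
  with assms(1) show "lincomb (length ?N) c (\<lambda>i. wd (?N ! i)) \<in> I_D4" by simp
  show "i < length ?N" using assms(2) by (simp add: length_g2_words)
qed

text \<open>A linear relation modulo \<open>I_G2\<close> maps to one modulo \<open>I_D4\<close>,
  where the images are independent.\<close>

lemma g2_basis_independent:
  assumes "lincomb 39 c g2_basis \<in> I_G2" "i < 39"
  shows "c i = 0"
  using phi_gen_ideal[OF assms(1)] assms(2)
  by (simp add: subst_phi_lincomb phi_basis_independent)

text \<open>Modulo \<open>I_G2\<close>, \<open>x\<close> is a combination of the 39 normal words.
  Independence of their images forces its coefficients to vanish.\<close>

lemma phi_injective:
  assumes "x \<in> FA" "subst phi_gen x \<in> I_D4"
  shows "x \<in> I_G2"
proof -
  obtain c where c: "fsub x (lincomb 39 c g2_basis) \<in> I_G2" using g2_span[OF assms(1)] by blast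
  have FA: "lincomb 39 c g2_basis \<in> FA" by (simp add: g2_basis_def)
  from phi_gen_ideal[OF c]
  have "fsub (subst phi_gen x) (subst phi_gen (lincomb 39 c g2_basis)) \<in> I_D4"
    using assms(1) FA by (simp add: subst_fsub)
  with assms(2) have "fsub (subst phi_gen x)
      (fsub (subst phi_gen x) (subst phi_gen (lincomb 39 c g2_basis))) \<in> I_D4"
    unfolding I_D4_def by (rule gen_ideal_fsub)
  then have "lincomb 39 c (\<lambda>i. subst phi_gen (g2_basis i)) \<in> I_D4"
    by (simp add: subst_phi_lincomb) (simp add: fsub_def)
  then have "\<And>i. i < 39 \<Longrightarrow> c i = 0" by (rule phi_basis_independent)
  then have "lincomb 39 c g2_basis = fzero" by (simp add: lincomb_def fzero_def)
  with c show ?thesis by (simp add: fsub_def fzero_def)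
qed

theorem theorem6p1:
  shows
    \<comment> \<open>phi is well defined on Br(G2) = FA/I_G2, as a map into Br(D4) = FA/I_D4\<close>
    "(\<forall>x\<in>I_G2. subst phi_gen x \<in> I_D4)
     \<comment> \<open>its image lies in SBr(D4)\<close>
   \<and> (\<forall>x\<in>(FA :: g2gen falg set). \<exists>y\<in>S_D4. fsub (subst phi_gen x) y \<in> I_D4)
     \<comment> \<open>it is onto SBr(D4)\<close>
   \<and> (\<forall>y\<in>S_D4. \<exists>x\<in>(FA :: g2gen falg set). fsub (subst phi_gen x) y \<in> I_D4)
     \<comment> \<open>it is injective\<close>
   \<and> (\<forall>x\<in>(FA :: g2gen falg set). subst phi_gen x \<in> I_D4 \<longrightarrow> x \<in> I_G2)
     \<comment> \<open>Br(G2) and SBr(D4) are free Z[delta^{+-1}]-modules of rank 39\<close>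
   \<and> free_of_rank_mod (FA :: g2gen falg set) I_G2 39
   \<and> free_of_rank_mod S_D4 I_D4 39"
proof (intro conjI ballI impI)
  show "subst phi_gen x \<in> I_D4" if "x \<in> I_G2" for x
    using that by (rule phi_gen_ideal)
  show "\<exists>y\<in>S_D4. fsub (subst phi_gen x) y \<in> I_D4" if "x \<in> FA" for x
    using that
    by (intro bexI[of _ "subst phi_gen x"]) (simp_all add: I_D4_def gi_zero subst_phi_S_D4)
  show "\<exists>x\<in>FA. fsub (subst phi_gen x) y \<in> I_D4" if "y \<in> S_D4" for y
    using that by (rule phi_onto_S_D4)
  show "x \<in> I_G2" if "x \<in> FA" "subst phi_gen x \<in> I_D4" for x
    using that by (rule phi_injective)
  show "free_of_rank_mod (FA :: g2gen falg set) I_G2 39"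
    unfolding free_of_rank_mod_def
    by (intro exI[of _ g2_basis] conjI allI impI ballI)
       (auto simp: g2_basis_def[of i for i] intro: g2_span g2_basis_independent)
  \<comment> \<open>Lift \<open>y\<close> to type G2, expand the lift in normal words and map the
    expansion back.\<close>
  have span: "\<exists>c. fsub y (lincomb 39 c (\<lambda>i. subst phi_gen (g2_basis i))) \<in> I_D4"
    if y: "y \<in> S_D4" for y
  proof -
    from phi_onto_S_D4[OF y] obtain x where x: "x \<in> FA" "fsub (subst phi_gen x) y \<in> I_D4" by blast
    from g2_span[OF x(1)] obtain c where c: "fsub x (lincomb 39 c g2_basis) \<in> I_G2" by blast
    have "lincomb 39 c g2_basis \<in> FA" by (simp add: g2_basis_def)
    with phi_gen_ideal[OF c] x(1)
    have "fsub (subst phi_gen x) (lincomb 39 c (\<lambda>i. subst phi_gen (g2_basis i))) \<in> I_D4"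
      by (simp add: subst_fsub subst_phi_lincomb)
    with x(2) show ?thesis
      unfolding I_D4_def by (blast intro: gen_ideal_fsub_swap gen_ideal_fsub_trans)
  qed
  show "free_of_rank_mod S_D4 I_D4 39"
    unfolding free_of_rank_mod_def
  proof (intro exI[of _ "\<lambda>i. subst phi_gen (g2_basis i)"] conjI allI impI ballI)
    show "subst phi_gen (g2_basis i) \<in> S_D4" for i
      by (rule subst_phi_S_D4) (simp add: g2_basis_def)
  qed (fact span phi_basis_independent)+
qed

end
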